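(* Let $r\ge2$ and let $F$ be a fixed $r$-graph with at least one edge and no isolated vertices. Let $\mathcal P$ be a property of finite simple $r$-graphs. Let $\mathcal W$ be a family of finite $r$-graphs, each with at least one edge. Suppose that every $r$-graph containing a member of $\mathcal W$ lies outside $\mathcal P$. Suppose also that $\mathcal W$ is $F$-abundant with constants $c,C>0$. Assume that membership in $\mathcal P$ is decidable and that there are constants $a,b>0$, with $a\le1$, such that every finite $r$-graph $G$ satisfies $\mathrm{dist}_F(G)\ge a\,\mathrm{dist}_{\mathcal P}(G)^b$. Then there are a graph $W_0\in\mathcal W$ and constants $\kappa,D>0$ such that, writing $K=W_0^\circ$, the following hold. (i) $v(K)\le\lfloor2r(C+1)\rfloor$. (ii) For every $0<\varepsilon\le1$ and every $n$, there is a one-sided $\varepsilon$-tester for $\mathcal P$ on $n$-vertex inputs which uses at most $\kappa\varepsilon^{-D}$ adjacency queries. (iii) For every fixed $\varepsilon$, on all sufficiently large inputs the tester in (ii) rejects only after finding a copy of the fixed graph $K$.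
   Context: An $r$-graph is a finite simple $r$-uniform hypergraph $H$; $v(H)$ and $e(H)$ are its numbers of vertices and edges. $H^\circ$ is obtained from $H$ by deleting all isolated vertices (vertices lying in no edge). A homomorphism $H\to G$ is a map $\phi:V(H)\to V(G)$ with $\phi(e)\in E(G)$ for every $e\in E(H)$; an embedding is an injective homomorphism; $\mathrm{Emb}(H,G)$ counts embeddings. $G$ contains $H$ (has a copy of $H$, not necessarily induced) if there is an embedding $H\to G$. An $n$-vertex $r$-graph $G$ is $\varepsilon$-far from being $F$-free if at least $\varepsilon n^r$ edges must be deleted from $G$ to destroy every copy of $F$; $\mathrm{dist}_F(G)$ is the minimum number of edges whose deletion makes $G$ $F$-free, divided by $v(G)^r$. A family $\mathcal W$ of $r$-graphs is $F$-abundant with constants $c,C>0$ if, for every $0<\varepsilon\le1$, there is $n_0(\varepsilon)$ for which every $n$-vertex $r$-graph $G$ with $n\ge n_0(\varepsilon)$ that is $\varepsilon$-far from being $F$-free admits some $H\in\mathcal W$ (possibly depending on $G$ and $\varepsilon$) with $\mathrm{Emb}(H,G)\ge c\varepsilon^Cn^{v(H)}$. A property $\mathcal P$ of $r$-graphs is a class of $r$-graphs closed under isomorphism; $\mathcal P_n$ denotes its members with $n$ vertices, and it is assumed that $\mathcal P_n\ne\varnothing$ for every $n$. For an $n$-vertex $r$-graph $G$, $\mathrm{dist}_{\mathcal P}(G)=\min\{|E(G)\triangle E(G')|/n^r: V(G')=V(G),\ G'\in\mathcal P_n\}$. Dense adjacency-query model: an adjacency query specifies an $r$-set $e\subseteq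 V(G)$ and asks whether $e\in E(G)$. For $0<\varepsilon\le1$, a one-sided $\varepsilon$-tester for $\mathcal P$ is a randomized algorithm with adjacency-query access to an $n$-vertex $r$-graph $G$ that always accepts when $G\in\mathcal P_n$ and rejects with probability at least $2/3$ when $\mathrm{dist}_{\mathcal P}(G)\ge\varepsilon$ (no condition when $0<\mathrm{dist}_{\mathcal P}(G)<\varepsilon$). The number of queries used means the maximum number of adjacency queries made by the tester. The constants $\kappa,D$ do not depend on $\varepsilon$ or $n$. "Rejects only after finding a copy of $K$" means that whenever the tester rejects, its positively answered queries include all edges of some copy of $K$ in $G$. *)

theory Defs
  imports Complex_Main "HOL-Library.FuncSet" "HOL-Library.Nat_Bijection"
begin

section \<open>Uniform hypergraphs\<close>

text \<open>Vertices are natural numbers; every finite hypergraph has an isomorphic copy of this form.\<close>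

record hgraph =
  verts :: "nat set"
  edges :: "nat set set"

definition rgraph :: "nat \<Rightarrow> hgraph \<Rightarrow> bool" where
  "rgraph r H \<longleftrightarrow> finite (verts H) \<and> (\<forall>e\<in>edges H. e \<subseteq> verts H \<and> card e = r)"

abbreviation order :: "hgraph \<Rightarrow> nat" where
  "order H \<equiv> card (verts H)"

definition core :: "hgraph \<Rightarrow> hgraph" where
  "core H = \<lparr>verts = {v \<in> verts H. \<exists>e\<in>edges H. v \<in> e}, edges = edges H\<rparr>"

text \<open>Maps are taken extensional outside \<open>verts H\<close>, so that they can be counted.\<close>

definition homs :: "hgraph \<Rightarrow> hgraph \<Rightarrow> (nat \<Rightarrow> nat) set" where
  "homs H G = {\<phi> \<in> verts H \<rightarrow>\<^sub>E verts G. \<forall>e\<in>edges H. \<phi> ` e \<in> edges G}"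

definition embs :: "hgraph \<Rightarrow> hgraph \<Rightarrow> (nat \<Rightarrow> nat) set" where
  "embs H G = {\<phi> \<in> homs H G. inj_on \<phi> (verts H)}"

definition Emb :: "hgraph \<Rightarrow> hgraph \<Rightarrow> nat" where
  "Emb H G = card (embs H G)"

definition contains_copy :: "hgraph \<Rightarrow> hgraph \<Rightarrow> bool" where
  "contains_copy G H \<longleftrightarrow> embs H G \<noteq> {}"

definition isomorphic :: "hgraph \<Rightarrow> hgraph \<Rightarrow> bool" where
  "isomorphic G G' \<longleftrightarrow>
     (\<exists>f. bij_betw f (verts G) (verts G') \<and> edges G' = (\<lambda>e. f ` e) ` edges G)"

section \<open>Distance from being \<open>F\<close>-free, and abundance\<close>

definition deletion_number :: "hgraph \<Rightarrow> hgraph \<Rightarrow> nat" where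
  "deletion_number F G =
     Min (card ` {X. X \<subseteq> edges G \<and> \<not> contains_copy (G\<lparr>edges := edges G - X\<rparr>) F})"

definition far_from_free :: "nat \<Rightarrow> hgraph \<Rightarrow> real \<Rightarrow> hgraph \<Rightarrow> bool" where
  "far_from_free r F \<epsilon> G \<longleftrightarrow> \<epsilon> * real (order G) ^ r \<le> real (deletion_number F G)"

definition dist_free :: "nat \<Rightarrow> hgraph \<Rightarrow> hgraph \<Rightarrow> real" where
  "dist_free r F G = real (deletion_number F G) / real (order G) ^ r"

definition abundant :: "nat \<Rightarrow> hgraph \<Rightarrow> hgraph set \<Rightarrow> real \<Rightarrow> real \<Rightarrow> bool" where
  "abundant r F W c C \<longleftrightarrow>
     (\<forall>\<epsilon>. 0 < \<epsilon> \<and> \<epsilon> \<le> 1 \<longrightarrow>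
        (\<exists>n0. \<forall>G. rgraph r G \<and> order G \<ge> n0 \<and> far_from_free r F \<epsilon> G \<longrightarrow>
           (\<exists>H\<in>W. real (Emb H G) \<ge> c * \<epsilon> powr C * real (order G) ^ order H)))"

section \<open>Properties\<close>

text \<open>As \<open>n\<close> ranges over all naturals, the (only) \<open>r\<close>-graph without vertices belongs to every
  property; its distances are \<open>0 / 0 = 0\<close>.\<close>

definition graph_property :: "nat \<Rightarrow> hgraph set \<Rightarrow> bool" where
  "graph_property r P \<longleftrightarrow>
     (\<forall>G\<in>P. rgraph r G) \<and>
     (\<forall>G\<in>P. \<forall>G'. isomorphic G G' \<longrightarrow> G' \<in> P) \<and>
     (\<forall>n. {G \<in> P. order G = n} \<noteq> {})"

definition dist_prop :: "nat \<Rightarrow> hgraph set \<Rightarrow> hgraph \<Rightarrow> real" where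
  "dist_prop r P G =
     Min ((\<lambda>G'. real (card ((edges G - edges G') \<union> (edges G' - edges G))) / real (order G) ^ r)
            ` {G' \<in> P. verts G' = verts G})"

section \<open>Computability\<close>

text \<open>The total recursive functions of Kleene (regular minimisation), with arguments given as a
  list. There are no arities: a missing argument counts as 0, and each function of the class reads
  only a bounded number of its arguments.\<close>

definition arg :: "nat \<Rightarrow> nat list \<Rightarrow> nat" where
  "arg i xs = (if i < length xs then xs ! i else 0)"

inductive recursive :: "(nat list \<Rightarrow> nat) \<Rightarrow> bool" where
  zero: "recursive (\<lambda>xs. 0)"
| succ: "recursive (\<lambda>xs. Suc (arg 0 xs))"
| proj: "recursive (arg i)"
| comp: "recursive f \<Longrightarrow> \<forall>g\<in>set gs. recursive g \<Longrightarrow> recursive (\<lambda>xs. f (map (\<lambda>g. g xs) gs))"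
| prim: "recursive f \<Longrightarrow> recursive g \<Longrightarrow>
    recursive (\<lambda>xs. rec_nat (f (tl xs)) (\<lambda>k y. g (k # y # tl xs)) (arg 0 xs))"
| mini: "recursive f \<Longrightarrow> \<forall>xs. \<exists>y. f (y # xs) = 0 \<Longrightarrow> recursive (\<lambda>xs. LEAST y. f (y # xs) = 0)"

text \<open>By closure under isomorphism it is enough to decide graphs with vertex set
  \<open>{0, \<dots>, n - 1}\<close>; these are coded by \<open>n\<close> and the code of the set of codes of their edges.\<close>

definition decidable_property :: "nat \<Rightarrow> hgraph set \<Rightarrow> bool" where
  "decidable_property r P \<longleftrightarrow>
     (\<exists>f. recursive f \<and>
        (\<forall>n G. rgraph r G \<and> verts G = {..<n} \<longrightarrow>
           (G \<in> P \<longleftrightarrow> f [n, set_encode (set_encode ` edges G)] = 1)))"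

section \<open>Randomized algorithms with adjacency queries\<close>

text \<open>An algorithm receives the number \<open>n\<close> of vertices of its input, whose vertex set is
  \<open>{0, \<dots>, n - 1}\<close>, and a seed drawn uniformly from \<open>{0, \<dots>, seeds A n - 1}\<close>. Its next move
  is determined by \<open>n\<close>, the seed, and the list of the answers received so far.\<close>

datatype action = Accept | Reject | Query "nat set"

record algorithm =
  seeds :: "nat \<Rightarrow> nat"
  move :: "nat \<Rightarrow> nat \<Rightarrow> bool list \<Rightarrow> action"

fun encode_action :: "action \<Rightarrow> nat" where
  "encode_action Accept = 0"
| "encode_action Reject = 1"
| "encode_action (Query e) = 2 + set_encode e"

text \<open>The list of answers is coded by its length and the set of positions of positive answers.\<close>

definition effective :: "algorithm \<Rightarrow> bool" where
  "effective A \<longleftrightarrow>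
     (\<exists>f. recursive f \<and> (\<forall>n. seeds A n = f [n])) \<and>
     (\<exists>g. recursive g \<and>
        (\<forall>n s bs. encode_action (move A n s bs) =
           g [n, s, length bs, set_encode {i. i < length bs \<and> bs ! i}]))"

text \<open>The queries and answers among the first \<open>k\<close> moves on the \<open>n\<close>-vertex input with edge
  set \<open>E\<close>; the transcript stays constant once the algorithm has accepted or rejected.\<close>

fun transcript :: "algorithm \<Rightarrow> nat \<Rightarrow> nat set set \<Rightarrow> nat \<Rightarrow> nat \<Rightarrow> (nat set \<times> bool) list" where
  "transcript A n E s 0 = []"
| "transcript A n E s (Suc k) =
     (let t = transcript A n E s k in
      case move A n s (map snd t) of Query e \<Rightarrow> t @ [(e, e \<in> E)] | _ \<Rightarrow> t)"

definition accepts :: "algorithm \<Rightarrow> nat \<Rightarrow> nat set set \<Rightarrow> nat \<Rightarrow> bool" where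
  "accepts A n E s \<longleftrightarrow> (\<exists>k. move A n s (map snd (transcript A n E s k)) = Accept)"

definition rejects :: "algorithm \<Rightarrow> nat \<Rightarrow> nat set set \<Rightarrow> nat \<Rightarrow> bool" where
  "rejects A n E s \<longleftrightarrow> (\<exists>k. move A n s (map snd (transcript A n E s k)) = Reject)"

definition inputs :: "nat \<Rightarrow> nat \<Rightarrow> hgraph set" where
  "inputs r n = {G. rgraph r G \<and> verts G = {..<n}}"

definition legal_queries :: "nat \<Rightarrow> nat \<Rightarrow> algorithm \<Rightarrow> bool" where
  "legal_queries r n A \<longleftrightarrow>
     (\<forall>G\<in>inputs r n. \<forall>s<seeds A n. \<forall>k. \<forall>(e, b)\<in>set (transcript A n (edges G) s k).
        e \<subseteq> {..<n} \<and> card e = r)"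

text \<open>A bound for all \<open>k\<close> also guarantees that every run halts.\<close>

definition queries_at_most :: "nat \<Rightarrow> nat \<Rightarrow> algorithm \<Rightarrow> real \<Rightarrow> bool" where
  "queries_at_most r n A q \<longleftrightarrow>
     (\<forall>G\<in>inputs r n. \<forall>s<seeds A n. \<forall>k. real (length (transcript A n (edges G) s k)) \<le> q)"

definition one_sided_tester :: "nat \<Rightarrow> hgraph set \<Rightarrow> real \<Rightarrow> nat \<Rightarrow> algorithm \<Rightarrow> bool" where
  "one_sided_tester r P \<epsilon> n A \<longleftrightarrow>
     seeds A n > 0 \<and> legal_queries r n A \<and>
     (\<forall>G\<in>inputs r n. G \<in> P \<longrightarrow> (\<forall>s<seeds A n. accepts A n (edges G) s)) \<and>
     (\<forall>G\<in>inputs r n. dist_prop r P G \<ge> \<epsilon> \<longrightarrow>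
        real (card {s. s < seeds A n \<and> rejects A n (edges G) s}) / real (seeds A n) \<ge> 2/3)"

definition rejects_only_after_finding :: "nat \<Rightarrow> hgraph \<Rightarrow> nat \<Rightarrow> algorithm \<Rightarrow> bool" where
  "rejects_only_after_finding r K n A \<longleftrightarrow>
     (\<forall>G\<in>inputs r n. \<forall>s<seeds A n. \<forall>k.
        move A n s (map snd (transcript A n (edges G) s k)) = Reject \<longrightarrow>
        (\<exists>\<phi>\<in>embs K G. \<forall>e\<in>edges K. (\<phi> ` e, True) \<in> set (transcript A n (edges G) s k)))"

end

theory Submission
  imports Defs "HOL-Library.Disjoint_Sets"
begin

text \<open>
  The proof works with homomorphism densities and with the tensor product of graphs. The density of a
  graph \<open>K\<close> in a product is at most the product of its densities in the factors
  (\<open>hom_density_tensor\<close>), whereas the distance from being \<open>F\<close>-free is supermultiplicative up to the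
  constant factor \<open>card (edges F)\<close> (\<open>deletion_number_tensor\<close>): maximal packings of edge-disjoint
  copies of \<open>F\<close> can be multiplied.

  Abundance offers for each host graph \<open>G\<close> some member of \<open>W\<close>, and only if \<open>G\<close> is large. Three
  operations on \<open>G\<close> turn this into a statement about one fixed graph and all \<open>G\<close>.

  \<^item> Blowing up \<open>G\<close> does not decrease its distance and does not increase densities, so the
  threshold on the order disappears (\<open>abundant_hom_density\<close>).

  \<^item> Taking \<open>s\<close> disjoint copies of \<open>G\<close> costs a factor \<open>s powr (1 - r)\<close> in the distance, but a factor
  of at least \<open>s powr (v * (1 - 1 / r))\<close> in the density of a graph of order \<open>v\<close> without isolated
  vertices. For suitable \<open>s\<close> only graphs with \<open>v \<le> r * (C + 1)\<close> can satisfy the abundance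
  inequality (\<open>abundant_bounded_order\<close>). This leaves finitely many candidates up to isomorphism.

  \<^item> If a finite family of candidates is abundant, so is one of its members: given bad graphs for two
  subfamilies, suitable tensor powers have comparable distances, and their product is bad for the
  union (\<open>no_two_bad_graphs\<close>, \<open>polynomially_abundant_Un\<close>).

  The result is a single core whose homomorphism density is at least a power of the distance in every
  host graph, small or large (\<open>ex_abundant_core\<close>). Non-injective homomorphisms are negligible once the
  order exceeds a polynomial in \<open>1 / \<epsilon>\<close>. Above this threshold polynomially many random samples find a
  copy of the core with probability at least \<open>2 / 3\<close>; below it, reading the whole input costs
  polynomially many queries (\<open>ex_tester\<close>). It is essential here that the density bound holds without a
  threshold on the order: one that depended on \<open>\<epsilon>\<close> in an uncontrolled way would spoil the query bound.
\<close>

section \<open>Deletion numbers under embeddings, packings and products\<close>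

definition hits :: "hgraph \<Rightarrow> hgraph \<Rightarrow> nat set set \<Rightarrow> bool" where
  "hits F G X \<longleftrightarrow> X \<subseteq> edges G \<and> (\<forall>\<phi>\<in>embs F G. \<exists>e\<in>edges F. \<phi> ` e \<in> X)"

lemma finite_edges: "rgraph r G \<Longrightarrow> finite (edges G)"
  by (rule finite_subset[of _ "Pow (verts G)"]) (auto simp: rgraph_def)

lemma finite_homs: "rgraph r K \<Longrightarrow> finite (verts G) \<Longrightarrow> finite (homs K G)"
  unfolding homs_def rgraph_def
  by (rule finite_subset[of _ "verts K \<rightarrow>\<^sub>E verts G"]) (auto intro: finite_PiE)

lemma finite_embs: "rgraph r K \<Longrightarrow> finite (verts G) \<Longrightarrow> finite (embs K G)"
  unfolding embs_def by (simp add: finite_homs)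

lemma not_contains_copy_deletion_iff:
  "\<not> contains_copy (G\<lparr>edges := edges G - X\<rparr>) F \<longleftrightarrow> (\<forall>\<phi>\<in>embs F G. \<exists>e\<in>edges F. \<phi> ` e \<in> X)"
  by (auto simp: contains_copy_def embs_def homs_def)

lemma deletion_number_eq: "deletion_number F G = Min (card ` {X. hits F G X})"
  by (simp add: deletion_number_def not_contains_copy_deletion_iff hits_def)

lemma finite_hits: "rgraph r G \<Longrightarrow> finite {X. hits F G X}"
  by (rule finite_subset[of _ "Pow (edges G)"]) (auto simp: hits_def finite_edges)

lemma deletion_number_le:
  assumes "rgraph r G" and "hits F G X"
  shows "deletion_number F G \<le> card X"
  unfolding deletion_number_eq using assms finite_hits by (intro Min_le) auto

lemma deletion_number_attained:
  assumes "rgraph r G" and "edges F \<noteq> {}"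
  shows "\<exists>X. hits F G X \<and> card X = deletion_number F G"
proof -
  have "hits F G (edges G)"
    using assms(2) by (auto simp: hits_def embs_def homs_def)
  then have "deletion_number F G \<in> card ` {X. hits F G X}"
    unfolding deletion_number_eq using finite_hits[OF assms(1)] by (intro Min_in) auto
  then show ?thesis by auto
qed

text \<open>A deletion set of \<open>H\<close> pulls back along every copy of \<open>G\<close> in \<open>H\<close> to a deletion set of \<open>G\<close>;
  averaging over a family of copies of \<open>G\<close> that covers no edge of \<open>H\<close> too often bounds the
  deletion number of \<open>H\<close> from below.\<close>

lemma deletion_number_of_copies:
  fixes \<sigma> :: "'i \<Rightarrow> nat \<Rightarrow> nat"
  assumes G: "rgraph r G" and H: "rgraph r H" and F: "edges F \<noteq> {}" "\<forall>e\<in>edges F. e \<subseteq> verts F"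
    and I: "finite I"
    and inj: "\<And>i. i \<in> I \<Longrightarrow> inj_on (\<sigma> i) (verts G)"
    and vert: "\<And>i. i \<in> I \<Longrightarrow> \<sigma> i ` verts G \<subseteq> verts H"
    and edge: "\<And>i e. i \<in> I \<Longrightarrow> e \<in> edges G \<Longrightarrow> \<sigma> i ` e \<in> edges H"
    and load: "\<And>x. x \<in> edges H \<Longrightarrow> card {i \<in> I. \<exists>e\<in>edges G. \<sigma> i ` e = x} \<le> M"
  shows "card I * deletion_number F G \<le> M * deletion_number F H"
proof -
  obtain X where X: "hits F H X" and cX: "card X = deletion_number F H"
    using deletion_number_attained[OF H F(1)] by blast
  have fX: "finite X" using X finite_edges[OF H] finite_subset by (auto simp: hits_def)
  define Y where "Y i = {e \<in> edges G. \<sigma> i ` e \<in> X}" for i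
  have fY: "finite (Y i)" for i using finite_edges[OF G] by (simp add: Y_def)
  have del: "deletion_number F G \<le> card (Y i)" if i: "i \<in> I" for i
  proof (rule deletion_number_le[OF G])
    show "hits F G (Y i)"
      unfolding hits_def
    proof (intro conjI ballI)
      show "Y i \<subseteq> edges G" by (auto simp: Y_def)
    next
      fix \<phi> assume \<phi>: "\<phi> \<in> embs F G"
      then have \<phi>v: "\<phi> ` verts F \<subseteq> verts G" by (auto simp: embs_def homs_def)
      define \<psi> where "\<psi> = restrict (\<sigma> i \<circ> \<phi>) (verts F)"
      have img: "\<psi> ` e = \<sigma> i ` \<phi> ` e" if "e \<in> edges F" for e
        using F(2) that by (force simp: \<psi>_def)
      have "inj_on (\<sigma> i \<circ> \<phi>) (verts F)"
        using \<phi> inj[OF i] \<phi>v by (intro comp_inj_on) (auto simp: embs_def intro: inj_on_subset)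
      moreover have "\<psi> \<in> verts F \<rightarrow>\<^sub>E verts H"
        using \<phi>v vert[OF i] by (fastforce simp: \<psi>_def)
      ultimately have "\<psi> \<in> embs F H"
        using \<phi> edge[OF i] by (auto simp: embs_def homs_def img) (simp add: \<psi>_def)
      then obtain e where e: "e \<in> edges F" "\<psi> ` e \<in> X" using X by (auto simp: hits_def)
      then have "\<phi> ` e \<in> Y i" using \<phi> by (auto simp: Y_def img embs_def homs_def)
      then show "\<exists>e\<in>edges F. \<phi> ` e \<in> Y i" using e by blast
    qed
  qed
  have "card I * deletion_number F G = (\<Sum>i\<in>I. deletion_number F G)" by simp
  also have "\<dots> \<le> (\<Sum>i\<in>I. card (Y i))" by (intro sum_mono del)
  also have "\<dots> = card (SIGMA i:I. Y i)" using I fY by simp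
  also have "\<dots> \<le> card (SIGMA x:X. {i \<in> I. \<exists>e\<in>edges G. \<sigma> i ` e = x})"
  proof (rule card_inj_on_le[where f = "\<lambda>(i, e). (\<sigma> i ` e, i)"])
    show "inj_on (\<lambda>(i, e). (\<sigma> i ` e, i)) (SIGMA i:I. Y i)"
    proof (rule inj_onI, clarsimp)
      fix i e e' assume "i \<in> I" "e \<in> Y i" "e' \<in> Y i" "\<sigma> i ` e = \<sigma> i ` e'"
      moreover from this have "e \<subseteq> verts G" "e' \<subseteq> verts G" using G by (auto simp: Y_def rgraph_def)
      ultimately show "e = e'" using inj inj_on_image_eq_iff by metis
    qed
    show "(\<lambda>(i, e). (\<sigma> i ` e, i)) ` (SIGMA i:I. Y i)
      \<subseteq> (SIGMA x:X. {i \<in> I. \<exists>e\<in>edges G. \<sigma> i ` e = x})"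
      by (auto simp: Y_def)
    show "finite (SIGMA x:X. {i \<in> I. \<exists>e\<in>edges G. \<sigma> i ` e = x})" using fX I by auto
  qed
  also have "\<dots> = (\<Sum>x\<in>X. card {i \<in> I. \<exists>e\<in>edges G. \<sigma> i ` e = x})" using fX I by simp
  also have "\<dots> \<le> (\<Sum>x\<in>X. M)" using X by (intro sum_mono load) (auto simp: hits_def)
  finally show ?thesis by (simp add: cX mult.commute)
qed

definition packing :: "hgraph \<Rightarrow> hgraph \<Rightarrow> (nat \<Rightarrow> nat) set \<Rightarrow> bool" where
  "packing F G \<Phi> \<longleftrightarrow> \<Phi> \<subseteq> embs F G \<and>
     disjoint_family_on (\<lambda>\<phi>. (`) \<phi> ` edges F) \<Phi>"

text \<open>A packing that cannot be enlarged meets every copy of \<open>F\<close> in an edge, so deleting all its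
  edges destroys every copy. This exchanges deletions for edge-disjoint copies, which, unlike
  deletion sets, can be multiplied.\<close>

lemma ex_large_packing:
  assumes G: "rgraph r G" and F: "rgraph r F" "edges F \<noteq> {}"
  shows "\<exists>\<Phi>. packing F G \<Phi> \<and> deletion_number F G \<le> card (edges F) * card \<Phi>"
proof -
  have fin: "finite (embs F G)" using finite_embs F(1) G by (auto simp: rgraph_def)
  have finp: "finite {\<Phi>. packing F G \<Phi>}"
    by (rule finite_subset[of _ "Pow (embs F G)"]) (auto simp: packing_def fin)
  have "packing F G {}" by (simp add: packing_def disjoint_family_on_def)
  then obtain \<Phi> where \<Phi>: "packing F G \<Phi>" and mx: "\<And>\<Psi>. packing F G \<Psi> \<Longrightarrow> \<not> \<Phi> \<subset> \<Psi>"
    using finite_has_maximal[OF finp] by blast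
  have f\<Phi>: "finite \<Phi>" using \<Phi> fin finite_subset by (auto simp: packing_def)
  define X where "X = (\<Union>\<phi>\<in>\<Phi>. (`) \<phi> ` edges F)"
  have "hits F G X"
    unfolding hits_def
  proof (intro conjI ballI)
    show "X \<subseteq> edges G" using \<Phi> by (auto simp: X_def packing_def embs_def homs_def)
  next
    fix \<psi> assume \<psi>: "\<psi> \<in> embs F G"
    show "\<exists>e\<in>edges F. \<psi> ` e \<in> X"
    proof (rule ccontr)
      assume "\<not> ?thesis"
      then have dis: "(`) \<psi> ` edges F \<inter> X = {}" by auto
      then have "\<psi> \<notin> \<Phi>" using F(2) by (auto simp: X_def)
      moreover have "packing F G (insert \<psi> \<Phi>)"
        using \<Phi> \<psi> dis by (auto simp: packing_def disjoint_family_on_insert X_def \<open>\<psi> \<notin> \<Phi>\<close>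
            disjoint_family_on_def)
      ultimately show False using mx by blast
    qed
  qed
  then have "deletion_number F G \<le> card X" by (rule deletion_number_le[OF G])
  also have "\<dots> \<le> (\<Sum>\<phi>\<in>\<Phi>. card ((`) \<phi> ` edges F))" unfolding X_def by (rule card_UN_le[OF f\<Phi>])
  also have "\<dots> \<le> (\<Sum>\<phi>\<in>\<Phi>. card (edges F))"
    by (intro sum_mono card_image_le finite_edges[OF F(1)])
  finally show ?thesis using \<Phi> by (auto simp: mult.commute)
qed

text \<open>The second factor need not be uniform: with all subsets of \<open>{..<N}\<close> as edges the
  product is the \<open>N\<close>-fold blow-up of the first factor, with all singletons it consists of \<open>N\<close>
  disjoint copies of it.\<close>

definition tensor :: "nat \<Rightarrow> hgraph \<Rightarrow> hgraph \<Rightarrow> hgraph" where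
  "tensor r G H = \<lparr>verts = prod_encode ` (verts G \<times> verts H),
     edges = {e. e \<subseteq> prod_encode ` (verts G \<times> verts H) \<and> card e = r \<and>
       (fst \<circ> prod_decode) ` e \<in> edges G \<and> (snd \<circ> prod_decode) ` e \<in> edges H}\<rparr>"

lemma verts_tensor: "verts (tensor r G H) = prod_encode ` (verts G \<times> verts H)"
  by (simp add: tensor_def)

lemma order_tensor: "order (tensor r G H) = order G * order H"
  unfolding verts_tensor by (subst card_image) (auto simp: card_cartesian_product inj_prod_encode)

lemma rgraph_tensor: "finite (verts G) \<Longrightarrow> finite (verts H) \<Longrightarrow> rgraph r (tensor r G H)"
  by (auto simp: rgraph_def tensor_def)

lemma tensor_edge_iff:
  "e \<in> edges (tensor r G H) \<longleftrightarrow> e \<subseteq> verts (tensor r G H) \<and> card e = r \<and>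
     (fst \<circ> prod_decode) ` e \<in> edges G \<and> (snd \<circ> prod_decode) ` e \<in> edges H"
  by (simp add: tensor_def)

lemma image_mem_tensor_edges:
  assumes G: "rgraph r G" and e: "finite e" "card e = r"
    and "f ` e \<in> edges G" and "g ` e \<in> edges H" and "g ` e \<subseteq> verts H"
  shows "(\<lambda>v. prod_encode (f v, g v)) ` e \<in> edges (tensor r G H)"
proof -
  have "card (f ` e) = card e" "f ` e \<subseteq> verts G" using assms by (auto simp: rgraph_def)
  then have inj: "inj_on f e" using e eq_card_imp_inj_on by blast
  then have "inj_on (\<lambda>v. prod_encode (f v, g v)) e"
    by (auto simp: inj_on_def inj_prod_encode[THEN inj_eq])
  then show ?thesis
    using assms \<open>f ` e \<subseteq> verts G\<close>
    by (auto simp: tensor_edge_iff verts_tensor card_image image_image comp_def)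
qed

text \<open>For a fixed copy \<open>\<phi>\<close> of \<open>F\<close> in the first factor, the pairs \<open>(\<phi>, \<psi>)\<close> with a copy \<open>\<psi>\<close> in
  the second factor are copies in the product. The deleted edges that lie over \<open>\<phi>\<close> therefore project
  to a deletion set of the second factor, and edge-disjoint copies \<open>\<phi>\<close> have disjoint sets of deleted
  edges over them.\<close>

lemma deletion_number_tensor_packing:
  assumes G: "rgraph r G" and H: "rgraph r H" and F: "rgraph r F" "edges F \<noteq> {}"
    and \<Phi>: "packing F G \<Phi>"
  shows "card \<Phi> * deletion_number F H \<le> deletion_number F (tensor r G H)"
proof -
  let ?T = "tensor r G H"
  have T: "rgraph r ?T" using G H by (intro rgraph_tensor) (auto simp: rgraph_def)
  obtain X where X: "hits F ?T X" and cX: "card X = deletion_number F ?T"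
    using deletion_number_attained[OF T F(2)] by blast
  have fX: "finite X" using X finite_edges[OF T] finite_subset by (auto simp: hits_def)
  have f\<Phi>: "finite \<Phi>"
    using \<Phi> finite_embs[OF F(1), of G] G finite_subset by (auto simp: packing_def rgraph_def)
  define Z where "Z \<phi> = {x \<in> X. (fst \<circ> prod_decode) ` x \<in> (`) \<phi> ` edges F}" for \<phi>
  have del: "deletion_number F H \<le> card (Z \<phi>)" if \<phi>: "\<phi> \<in> \<Phi>" for \<phi>
  proof -
    have \<phi>e: "\<phi> \<in> embs F G" using \<phi> \<Phi> by (auto simp: packing_def)
    have "hits F H ((\<lambda>x. (snd \<circ> prod_decode) ` x) ` Z \<phi>)"
      unfolding hits_def
    proof (intro conjI ballI)
      show "(\<lambda>x. (snd \<circ> prod_decode) ` x) ` Z \<phi> \<subseteq> edges H"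
        using X by (auto simp: Z_def hits_def tensor_edge_iff subset_iff)
    next
      fix \<psi> assume \<psi>: "\<psi> \<in> embs F H"
      define \<chi> where "\<chi> = restrict (\<lambda>v. prod_encode (\<phi> v, \<psi> v)) (verts F)"
      have sub: "e \<subseteq> verts F" "finite e" "card e = r" if "e \<in> edges F" for e
        using that F(1) finite_subset by (auto simp: rgraph_def)
      have img: "\<chi> ` e = (\<lambda>v. prod_encode (\<phi> v, \<psi> v)) ` e" if "e \<in> edges F" for e
        using sub[OF that] by (force simp: \<chi>_def)
      have "\<chi> ` e \<in> edges ?T" if "e \<in> edges F" for e
        unfolding img[OF that] using sub[OF that] \<phi>e \<psi> that
        by (intro image_mem_tensor_edges G) (auto simp: embs_def homs_def)
      moreover have "\<chi> \<in> verts F \<rightarrow>\<^sub>E verts ?T"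
        using \<phi>e \<psi> by (auto simp: \<chi>_def verts_tensor embs_def homs_def)
      moreover have "inj_on \<chi> (verts F)"
        using \<phi>e by (auto simp: \<chi>_def embs_def inj_on_def inj_prod_encode[THEN inj_eq])
      ultimately have "\<chi> \<in> embs F ?T" by (auto simp: embs_def homs_def)
      then obtain e where e: "e \<in> edges F" "\<chi> ` e \<in> X" using X by (auto simp: hits_def)
      have "(fst \<circ> prod_decode) ` \<chi> ` e = \<phi> ` e" "(snd \<circ> prod_decode) ` \<chi> ` e = \<psi> ` e"
        unfolding img[OF e(1)] by (auto simp: image_image)
      then have "\<chi> ` e \<in> Z \<phi>" "\<psi> ` e = (snd \<circ> prod_decode) ` \<chi> ` e"
        using e by (auto simp: Z_def)
      then show "\<exists>e\<in>edges F. \<psi> ` e \<in> (\<lambda>x. (snd \<circ> prod_decode) ` x) ` Z \<phi>"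
        using e by blast
    qed
    then have "deletion_number F H \<le> card ((\<lambda>x. (snd \<circ> prod_decode) ` x) ` Z \<phi>)"
      by (rule deletion_number_le[OF H])
    also have "\<dots> \<le> card (Z \<phi>)" using fX by (intro card_image_le) (auto simp: Z_def)
    finally show ?thesis .
  qed
  have "disjoint_family_on Z \<Phi>"
    using \<Phi> unfolding packing_def disjoint_family_on_def Z_def by blast
  then have "(\<Sum>\<phi>\<in>\<Phi>. card (Z \<phi>)) = card (\<Union>\<phi>\<in>\<Phi>. Z \<phi>)"
    using f\<Phi> fX by (intro card_UN_disjoint[symmetric]) (auto simp: Z_def disjoint_family_on_def)
  also have "\<dots> \<le> card X" using fX by (intro card_mono) (auto simp: Z_def)
  finally have "(\<Sum>\<phi>\<in>\<Phi>. card (Z \<phi>)) \<le> deletion_number F ?T" by (simp add: cX)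
  moreover have "(\<Sum>\<phi>\<in>\<Phi>. deletion_number F H) \<le> (\<Sum>\<phi>\<in>\<Phi>. card (Z \<phi>))"
    by (intro sum_mono del)
  ultimately show ?thesis by simp
qed

lemma deletion_number_tensor:
  assumes G: "rgraph r G" and H: "rgraph r H" and F: "rgraph r F" "edges F \<noteq> {}"
  shows "deletion_number F G * deletion_number F H
    \<le> card (edges F) * deletion_number F (tensor r G H)"
proof -
  obtain \<Phi> where \<Phi>: "packing F G \<Phi>" "deletion_number F G \<le> card (edges F) * card \<Phi>"
    using ex_large_packing[OF G F] by blast
  have "deletion_number F G * deletion_number F H
      \<le> card (edges F) * (card \<Phi> * deletion_number F H)"
    using mult_le_mono1[OF \<Phi>(2)] by (simp add: mult.assoc)
  also have "\<dots> \<le> card (edges F) * deletion_number F (tensor r G H)"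
    using deletion_number_tensor_packing[OF G H F \<Phi>(1)] by simp
  finally show ?thesis .
qed

abbreviation blow_up :: "nat \<Rightarrow> hgraph \<Rightarrow> nat \<Rightarrow> hgraph" where
  "blow_up r G N \<equiv> tensor r G \<lparr>verts = {..<N}, edges = Pow {..<N}\<rparr>"

abbreviation copies :: "nat \<Rightarrow> hgraph \<Rightarrow> nat \<Rightarrow> hgraph" where
  "copies r G N \<equiv> tensor r G \<lparr>verts = {..<N}, edges = (\<lambda>i. {i}) ` {..<N}\<rparr>"

text \<open>A bound for families of maps that are determined by their restriction to the complement of \<open>S\<close>.\<close>

lemma card_PiE_agreeing:
  assumes V: "finite V" and B: "finite B" and S: "S \<subseteq> V"
    and det: "\<And>f g. f \<in> A \<Longrightarrow> g \<in> A \<Longrightarrow> (\<forall>v\<in>V - S. f v = g v) \<Longrightarrow> \<forall>v\<in>S. f v = g v"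
    and A: "A \<subseteq> V \<rightarrow>\<^sub>E B"
  shows "card A \<le> card B ^ (card V - card S)"
proof -
  have "card A \<le> card ((V - S) \<rightarrow>\<^sub>E B)"
  proof (rule card_inj_on_le[where f = "\<lambda>f. restrict f (V - S)"])
    show "inj_on (\<lambda>f. restrict f (V - S)) A"
    proof (rule inj_onI)
      fix f g assume fg: "f \<in> A" "g \<in> A" "restrict f (V - S) = restrict g (V - S)"
      have *: "f v = g v" if "v \<in> V - S" for v
        using fun_cong[OF fg(3), of v] that by simp
      then have "\<forall>v\<in>S. f v = g v" using det fg by blast
      then show "f = g" using * fg A by (intro PiE_ext[of f V "\<lambda>_. B" g]) auto
    qed
    show "(\<lambda>f. restrict f (V - S)) ` A \<subseteq> (V - S) \<rightarrow>\<^sub>E B"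
      using A by (force simp: PiE_iff)
    show "finite ((V - S) \<rightarrow>\<^sub>E B)" using V B by (intro finite_PiE) auto
  qed
  also have "\<dots> = card B ^ (card V - card S)"
    using V S by (simp add: card_PiE card_Diff_subset finite_subset)
  finally show ?thesis .
qed

text \<open>Every map from the vertices to \<open>{..<N}\<close> is a section of the blow-up and gives a copy of \<open>G\<close> in
  it. An edge of the blow-up prescribes the section on \<open>r\<close> vertices, so it lies in a fraction
  \<open>1 / N ^ r\<close> of these copies.\<close>

lemma deletion_number_blow_up:
  assumes G: "rgraph r G" and F: "edges F \<noteq> {}" "\<forall>e\<in>edges F. e \<subseteq> verts F" and N: "N > 0"
    and ne: "edges G \<noteq> {}"
  shows "N ^ r * deletion_number F G \<le> deletion_number F (blow_up r G N)"
proof -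
  let ?H = "blow_up r G N"
  have fin: "finite (verts G)" using G by (auto simp: rgraph_def)
  have H: "rgraph r ?H" using fin by (intro rgraph_tensor) auto
  let ?I = "verts G \<rightarrow>\<^sub>E {..<N}"
  let ?\<sigma> = "\<lambda>f v. prod_encode (v, f v)"
  have fI: "finite ?I" using fin by (intro finite_PiE) auto
  have "card ?I * deletion_number F G \<le> N ^ (order G - r) * deletion_number F ?H"
  proof (rule deletion_number_of_copies[OF G H F fI, of ?\<sigma>])
    show "inj_on (?\<sigma> f) (verts G)" for f
      by (auto simp: inj_on_def inj_prod_encode[THEN inj_eq])
    show "?\<sigma> f ` verts G \<subseteq> verts ?H" if "f \<in> ?I" for f using that by (auto simp: verts_tensor)
    show "?\<sigma> f ` e \<in> edges ?H" if "f \<in> ?I" "e \<in> edges G" for f e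
    proof -
      have e: "e \<subseteq> verts G" "finite e" "card e = r"
        using G that finite_subset by (auto simp: rgraph_def)
      show ?thesis
        using e that
        by (intro image_mem_tensor_edges[OF G e(2,3), where f = "\<lambda>v. v" and g = f]) auto
    qed
    fix x assume x: "x \<in> edges ?H"
    have e0: "(fst \<circ> prod_decode) ` x \<in> edges G" using x by (auto simp: tensor_edge_iff)
    define S where "S = (fst \<circ> prod_decode) ` x"
    have S: "S \<subseteq> verts G" "card S = r" using e0 G by (auto simp: S_def rgraph_def)
    have "card {f \<in> ?I. \<exists>e\<in>edges G. ?\<sigma> f ` e = x} \<le> card {..<N} ^ (card (verts G) - card S)"
    proof (rule card_PiE_agreeing[OF fin _ S(1)])
      fix f g assume f: "f \<in> {f \<in> ?I. \<exists>e\<in>edges G. ?\<sigma> f ` e = x}"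
        and g: "g \<in> {f \<in> ?I. \<exists>e\<in>edges G. ?\<sigma> f ` e = x}"
      show "\<forall>v\<in>S. f v = g v"
      proof
        fix v assume "v \<in> S"
        then obtain w where w: "w \<in> x" "v = fst (prod_decode w)" by (auto simp: S_def)
        from f g w(1) have "w \<in> range (?\<sigma> f)" "w \<in> range (?\<sigma> g)" by blast+
        then show "f v = g v" using w(2) by auto
      qed
    qed auto
    then show "card {f \<in> ?I. \<exists>e\<in>edges G. ?\<sigma> f ` e = x} \<le> N ^ (order G - r)" by (simp add: S)
  qed
  moreover have "card ?I = N ^ order G" using fin by (simp add: card_PiE)
  moreover obtain e where "e \<in> edges G" using ne by auto
  then have "r \<le> order G" using G card_mono[OF fin, of e] by (auto simp: rgraph_def)
  then have "N ^ order G = N ^ (order G - r) * N ^ r" by (simp flip: power_add)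
  ultimately have "N ^ (order G - r) * (N ^ r * deletion_number F G)
      \<le> N ^ (order G - r) * deletion_number F ?H" by (simp add: mult.assoc)
  then show ?thesis using N by simp
qed

lemma deletion_number_copies:
  assumes G: "rgraph r G" and F: "edges F \<noteq> {}" "\<forall>e\<in>edges F. e \<subseteq> verts F" and r: "r > 0"
  shows "N * deletion_number F G \<le> deletion_number F (copies r G N)"
proof -
  let ?H = "copies r G N"
  have fin: "finite (verts G)" using G by (auto simp: rgraph_def)
  have H: "rgraph r ?H" using fin by (intro rgraph_tensor) auto
  let ?\<sigma> = "\<lambda>i v. prod_encode (v, i)"
  have "card {..<N} * deletion_number F G \<le> 1 * deletion_number F ?H"
  proof (rule deletion_number_of_copies[OF G H F, of _ ?\<sigma>])
    show "inj_on (?\<sigma> i) (verts G)" for i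
      by (auto simp: inj_on_def inj_prod_encode[THEN inj_eq])
    show "?\<sigma> i ` verts G \<subseteq> verts ?H" if "i \<in> {..<N}" for i using that by (auto simp: verts_tensor)
    show "?\<sigma> i ` e \<in> edges ?H" if "i \<in> {..<N}" "e \<in> edges G" for i e
    proof -
      have e: "e \<subseteq> verts G" "finite e" "card e = r" "e \<noteq> {}"
        using G r that finite_subset by (auto simp: rgraph_def)
      have "(\<lambda>v. i) ` e = {i}" using e by auto
      then show ?thesis
        using image_mem_tensor_edges[OF G e(2,3), where f = "\<lambda>v. v" and g = "\<lambda>_. i"] e that
        by auto
    qed
    fix x assume x: "x \<in> edges ?H"
    show "card {i \<in> {..<N}. \<exists>e\<in>edges G. ?\<sigma> i ` e = x} \<le> 1"
    proof (rule card_le_Suc0_iff_eq[THEN iffD2, unfolded One_nat_def[symmetric]])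
      show "\<forall>i\<in>{i \<in> {..<N}. \<exists>e\<in>edges G. ?\<sigma> i ` e = x}.
        \<forall>j\<in>{i \<in> {..<N}. \<exists>e\<in>edges G. ?\<sigma> i ` e = x}. i = j"
      proof (intro ballI)
        fix i j assume ij: "i \<in> {i \<in> {..<N}. \<exists>e\<in>edges G. ?\<sigma> i ` e = x}"
          "j \<in> {i \<in> {..<N}. \<exists>e\<in>edges G. ?\<sigma> i ` e = x}"
        have "x \<noteq> {}" using x r by (auto simp: tensor_edge_iff)
        then obtain w where "w \<in> x" by auto
        with ij have "w \<in> range (?\<sigma> i)" "w \<in> range (?\<sigma> j)" by blast+
        then show "i = j" by (auto simp: inj_prod_encode[THEN inj_eq])
      qed
    qed auto
  qed auto
  then show ?thesis by simp
qed

section \<open>Homomorphism densities\<close>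

definition hom_density :: "hgraph \<Rightarrow> hgraph \<Rightarrow> real" where
  "hom_density K G = real (card (homs K G)) / real (order G) ^ order K"

lemma hom_density_nonneg: "hom_density K G \<ge> 0"
  by (simp add: hom_density_def)

lemma card_homs_le:
  assumes "rgraph r K" and "finite (verts G)"
  shows "card (homs K G) \<le> order G ^ order K"
proof -
  have fK: "finite (verts K)" using assms by (auto simp: rgraph_def)
  have "card (homs K G) \<le> card (verts K \<rightarrow>\<^sub>E verts G)"
    using fK assms(2) by (intro card_mono finite_PiE) (auto simp: homs_def)
  then show ?thesis using fK by (simp add: card_PiE)
qed

lemma hom_density_le_1:
  assumes "rgraph r K" and "finite (verts G)"
  shows "hom_density K G \<le> 1"
  using card_homs_le[OF assms]
  by (auto simp: hom_density_def divide_le_eq_1 simp flip: of_nat_power)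

text \<open>A homomorphism into a product is a pair of homomorphisms, given by its two projections.\<close>

lemma hom_density_tensor:
  assumes K: "rgraph r K" and G: "finite (verts G)" and H: "finite (verts H)"
  shows "hom_density K (tensor k G H) \<le> hom_density K G * hom_density K H"
proof -
  let ?T = "tensor k G H"
  have Ksub: "e \<subseteq> verts K" if "e \<in> edges K" for e using K that by (auto simp: rgraph_def)
  define p where
    "p \<phi> = (restrict (fst \<circ> prod_decode \<circ> \<phi>) (verts K), restrict (snd \<circ> prod_decode \<circ> \<phi>) (verts K))"
    for \<phi> :: "nat \<Rightarrow> nat"
  have "card (homs K ?T) \<le> card (homs K G \<times> homs K H)"
  proof (rule card_inj_on_le[where f = p])
    show "inj_on p (homs K ?T)"
    proof (rule inj_onI)
      fix \<phi> \<psi> assume *: "\<phi> \<in> homs K ?T" "\<psi> \<in> homs K ?T" "p \<phi> = p \<psi>"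
      have "\<phi> v = \<psi> v" if "v \<in> verts K" for v
      proof -
        have "fst (prod_decode (\<phi> v)) = fst (prod_decode (\<psi> v))"
          using fun_cong[of _ _ v, OF arg_cong[OF *(3), of fst]] that by (simp add: p_def)
        moreover have "snd (prod_decode (\<phi> v)) = snd (prod_decode (\<psi> v))"
          using fun_cong[of _ _ v, OF arg_cong[OF *(3), of snd]] that by (simp add: p_def)
        ultimately have "prod_decode (\<phi> v) = prod_decode (\<psi> v)" by (rule prod_eqI)
        then show ?thesis using prod_decode_eq by blast
      qed
      then show "\<phi> = \<psi>" using * by (auto simp: homs_def intro: PiE_ext)
    qed
    show "p ` homs K ?T \<subseteq> homs K G \<times> homs K H"
    proof
      fix y assume "y \<in> p ` homs K ?T"
      then obtain \<phi> where \<phi>: "\<phi> \<in> homs K ?T" and y: "y = p \<phi>" by auto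
      have v: "prod_decode (\<phi> v) \<in> verts G \<times> verts H" if "v \<in> verts K" for v
      proof -
        have "\<phi> v \<in> prod_encode ` (verts G \<times> verts H)"
          using \<phi> that by (auto simp: homs_def verts_tensor)
        then show ?thesis by (metis imageE prod_encode_inverse)
      qed
      have e: "(fst \<circ> prod_decode \<circ> \<phi>) ` e \<in> edges G" "(snd \<circ> prod_decode \<circ> \<phi>) ` e \<in> edges H"
        if "e \<in> edges K" for e
        using \<phi> that by (auto simp: homs_def tensor_edge_iff image_comp comp_assoc)
      have img: "restrict f (verts K) ` e = f ` e" if "e \<in> edges K" for e and f :: "nat \<Rightarrow> nat"
        using Ksub[OF that] by force
      have "\<forall>e\<in>edges K. restrict (fst \<circ> prod_decode \<circ> \<phi>) (verts K) ` e \<in> edges G"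
        "\<forall>e\<in>edges K. restrict (snd \<circ> prod_decode \<circ> \<phi>) (verts K) ` e \<in> edges H"
        using e img by metis+
      then show "y \<in> homs K G \<times> homs K H"
        unfolding y p_def homs_def using v by (auto simp: mem_Times_iff)
    qed
    show "finite (homs K G \<times> homs K H)" using finite_homs[OF K] G H by auto
  qed
  then have "real (card (homs K ?T)) \<le> real (card (homs K G)) * real (card (homs K H))"
    by (simp add: card_cartesian_product flip: of_nat_mult)
  then show ?thesis
    by (simp add: hom_density_def order_tensor power_mult_distrib divide_right_mono)
qed

lemma hom_density_tensor_left:
  assumes "rgraph r K" and "finite (verts G)" and "finite (verts H)"
  shows "hom_density K (tensor k G H) \<le> hom_density K G"
  using hom_density_tensor[OF assms, of k]
    mult_left_mono[OF hom_density_le_1[OF assms(1,3)] hom_density_nonneg, of K G] by simp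

lemma hom_density_tensor_right:
  assumes "rgraph r K" and "finite (verts G)" and "finite (verts H)"
  shows "hom_density K (tensor k G H) \<le> hom_density K H"
  using hom_density_tensor[OF assms, of k]
    mult_right_mono[OF hom_density_le_1[OF assms(1,2)] hom_density_nonneg, of K H] by simp

lemma edges_core [simp]: "edges (core H) = edges H"
  by (simp add: core_def)

lemma rgraph_core: "rgraph r H \<Longrightarrow> rgraph r (core H)"
  by (auto simp: rgraph_def core_def)

text \<open>An isolated vertex contributes at most a factor \<open>order G\<close> to the number of embeddings, so deleting
  it does not decrease the density.\<close>

lemma Emb_le_hom_density_core:
  assumes H: "rgraph r H" and G: "finite (verts G)" "order G > 0"
  shows "real (Emb H G) \<le> hom_density (core H) G * real (order G) ^ order H"
proof -
  let ?V = "verts H" and ?S = "verts (core H)"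
  have fV: "finite ?V" and S: "?S \<subseteq> ?V" using H by (auto simp: rgraph_def core_def)
  then have fS: "finite ?S" using finite_subset by blast
  have Hsub: "e \<subseteq> ?S" if "e \<in> edges H" for e using H that by (auto simp: rgraph_def core_def)
  let ?p = "\<lambda>\<phi>. (restrict \<phi> ?S, restrict \<phi> (?V - ?S))"
  have "Emb H G \<le> card (homs (core H) G \<times> (?V - ?S \<rightarrow>\<^sub>E verts G))"
    unfolding Emb_def
  proof (rule card_inj_on_le[where f = ?p])
    show "inj_on ?p (embs H G)"
    proof (rule inj_onI)
      fix \<phi> \<psi> assume *: "\<phi> \<in> embs H G" "\<psi> \<in> embs H G" "?p \<phi> = ?p \<psi>"
      then have 1: "restrict \<phi> ?S = restrict \<psi> ?S" "restrict \<phi> (?V - ?S) = restrict \<psi> (?V - ?S)" by auto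
      have "\<phi> v = \<psi> v" if "v \<in> ?V" for v
        using fun_cong[OF 1(1), of v] fun_cong[OF 1(2), of v] that by (cases "v \<in> ?S") auto
      then show "\<phi> = \<psi>" using * by (auto simp: homs_def embs_def intro: PiE_ext)
    qed
    show "?p ` embs H G \<subseteq> homs (core H) G \<times> (?V - ?S \<rightarrow>\<^sub>E verts G)"
    proof
      fix y assume "y \<in> ?p ` embs H G"
      then obtain \<phi> where \<phi>: "\<phi> \<in> embs H G" and y: "y = ?p \<phi>" by auto
      have img: "restrict \<phi> ?S ` e = \<phi> ` e" if "e \<in> edges H" for e
        using Hsub[OF that] by force
      have "\<forall>e\<in>edges (core H). restrict \<phi> ?S ` e \<in> edges G"
        using \<phi> by (metis (no_types, lifting) edges_core embs_def homs_def img mem_Collect_eq)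
      then show "y \<in> homs (core H) G \<times> (?V - ?S \<rightarrow>\<^sub>E verts G)"
        unfolding y homs_def using \<phi> S by (auto simp: embs_def homs_def)
    qed
    show "finite (homs (core H) G \<times> (?V - ?S \<rightarrow>\<^sub>E verts G))"
      using finite_homs[OF rgraph_core[OF H] G(1)] fV G(1) by (auto intro!: finite_PiE)
  qed
  also have "\<dots> = card (homs (core H) G) * order G ^ (order H - order (core H))"
    using fV fS S by (simp add: card_cartesian_product card_PiE card_Diff_subset)
  finally have "real (Emb H G) \<le> real (card (homs (core H) G)) * real (order G) ^ (order H - order (core H))"
    by (simp flip: of_nat_mult of_nat_power)
  also have "\<dots> = hom_density (core H) G * real (order G) ^ order H"
  proof -
    have "order H = order (core H) + (order H - order (core H))"
      using card_mono[OF fV S] by simp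
    then have "real (order G) ^ order H
        = real (order G) ^ order (core H) * real (order G) ^ (order H - order (core H))"
      by (metis power_add)
    then show ?thesis using G(2) by (simp add: hom_density_def)
  qed
  finally show ?thesis .
qed

text \<open>A map into the one-point edges is constant along every edge, so it is determined by
  one value per connected component, and a component has at least \<open>r\<close> vertices. Instead of
  components the proof uses the coarsest partition into sets on which all these maps are constant.\<close>

lemma card_homs_singletons:
  assumes K: "rgraph r K" and iso: "\<forall>v\<in>verts K. \<exists>e\<in>edges K. v \<in> e" and r: "r > 0"
  shows "\<exists>q. r * q \<le> order K \<and>
    card (homs K \<lparr>verts = {..<s}, edges = (\<lambda>i. {i}) ` {..<s}\<rparr>) \<le> s ^ q"
proof -
  let ?U = "\<lparr>verts = {..<s}, edges = (\<lambda>i. {i}) ` {..<s}\<rparr> :: hgraph" and ?V = "verts K"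
  have fV: "finite ?V" using K by (auto simp: rgraph_def)
  define R where "R = {(x, y). x \<in> ?V \<and> y \<in> ?V \<and> (\<forall>f\<in>homs K ?U. f x = f y)}"
  have eq: "equiv ?V R" by (auto simp: R_def equiv_def refl_on_def sym_def trans_def)
  have fQ: "finite (?V // R)" by (rule finite_quotient[OF fV]) (auto simp: R_def)
  have big: "r \<le> card X" if X: "X \<in> ?V // R" for X
  proof -
    obtain x where x: "x \<in> ?V" "X = R `` {x}" using X by (auto simp: quotient_def)
    obtain e where e: "e \<in> edges K" "x \<in> e" using iso x(1) by auto
    have "e \<subseteq> X"
    proof
      fix y assume y: "y \<in> e"
      have "f x = f y" if f: "f \<in> homs K ?U" for f
      proof -
        have "f ` e \<in> (\<lambda>i. {i}) ` {..<s}" using f e(1) by (auto simp: homs_def)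
        then obtain i where "f ` e = {i}" by auto
        then show ?thesis using e(2) y by (metis imageI singletonD)
      qed
      then show "y \<in> X" using x(1) e(1) y K by (auto simp: x(2) R_def rgraph_def)
    qed
    moreover have "finite X" using X fV eq by (meson finite_equiv_class[OF fV] equiv_type)
    ultimately have "card e \<le> card X" by (intro card_mono)
    then show ?thesis using e K by (auto simp: rgraph_def)
  qed
  have "r * card (?V // R) \<le> (\<Sum>X\<in>?V // R. card X)"
    using sum_bounded_below[of "?V // R" r card] big by (simp add: mult.commute)
  also have "\<dots> = card (\<Union> (?V // R))"
    using eq fV by (intro card_Union_disjoint[symmetric])
      (auto simp: pairwise_def disjnt_def dest: quotient_disj intro: finite_equiv_class[OF fV equiv_type[OF eq]])
  also have "\<dots> = order K" by (simp add: Union_quotient[OF eq])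
  finally have q: "r * card (?V // R) \<le> order K" .
  have "card (homs K ?U) \<le> card ((?V // R) \<rightarrow>\<^sub>E {..<s})"
  proof (rule card_inj_on_le[where f = "\<lambda>f. \<lambda>X\<in>?V // R. f (SOME x. x \<in> X)"])
    have some: "(SOME x. x \<in> X) \<in> X" if "X \<in> ?V // R" for X
      using in_quotient_imp_non_empty[OF eq that] by (simp add: some_in_eq)
    show "inj_on (\<lambda>f. \<lambda>X\<in>?V // R. f (SOME x. x \<in> X)) (homs K ?U)"
    proof (rule inj_onI)
      fix f g assume *: "f \<in> homs K ?U" "g \<in> homs K ?U"
        "(\<lambda>X\<in>?V // R. f (SOME x. x \<in> X)) = (\<lambda>X\<in>?V // R. g (SOME x. x \<in> X))"
      have "f x = g x" if x: "x \<in> ?V" for x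
      proof -
        define z where "z = (SOME z. z \<in> R `` {x})"
        have X: "R `` {x} \<in> ?V // R" using x by (auto simp: quotient_def)
        then have "(x, z) \<in> R" using some[OF X] unfolding z_def by blast
        then have "f x = f z" "g x = g z" using * by (auto simp: R_def)
        moreover have "f z = g z" using fun_cong[OF *(3), of "R `` {x}"] X by (simp add: z_def)
        ultimately show ?thesis by simp
      qed
      then show "f = g" using * by (auto simp: homs_def intro: PiE_ext)
    qed
    show "(\<lambda>f. \<lambda>X\<in>?V // R. f (SOME x. x \<in> X)) ` homs K ?U \<subseteq> (?V // R) \<rightarrow>\<^sub>E {..<s}"
    proof
      fix h assume "h \<in> (\<lambda>f. \<lambda>X\<in>?V // R. f (SOME x. x \<in> X)) ` homs K ?U"
      then obtain f where f: "f \<in> homs K ?U" and h: "h = (\<lambda>X\<in>?V // R. f (SOME x. x \<in> X))" by auto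
      have "(SOME x. x \<in> X) \<in> ?V" if "X \<in> ?V // R" for X
        using some[OF that] that Union_quotient[OF eq] by blast
      then show "h \<in> (?V // R) \<rightarrow>\<^sub>E {..<s}" using f by (auto simp: h homs_def)
    qed
    show "finite ((?V // R) \<rightarrow>\<^sub>E {..<s})" using fQ by (intro finite_PiE) auto
  qed
  also have "\<dots> = s ^ card (?V // R)" using fQ by (simp add: card_PiE)
  finally show ?thesis using q by blast
qed

lemma hom_density_copies:
  assumes K: "rgraph r K" and iso: "\<forall>v\<in>verts K. \<exists>e\<in>edges K. v \<in> e" and r: "r > 0"
    and G: "finite (verts G)" and s: "s \<ge> 1"
  shows "hom_density K (copies k G s) \<le> real s powr (real (order K) / r - real (order K))"
proof -
  let ?U = "\<lparr>verts = {..<s}, edges = (\<lambda>i. {i}) ` {..<s}\<rparr> :: hgraph"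
  obtain q where q: "r * q \<le> order K" "card (homs K ?U) \<le> s ^ q"
    using card_homs_singletons[OF K iso r] by blast
  have "hom_density K (copies k G s) \<le> hom_density K ?U"
    by (rule hom_density_tensor_right[OF K G]) simp
  also have "\<dots> \<le> real s ^ q / real s ^ order K"
    using q(2) by (auto simp: hom_density_def intro!: divide_right_mono simp flip: of_nat_power)
  also have "\<dots> = real s powr (real q - real (order K))"
    using s by (simp add: powr_diff powr_realpow)
  also have "\<dots> \<le> real s powr (real (order K) / r - real (order K))"
  proof -
    have "real r * real q \<le> real (order K)" using q(1) by (simp flip: of_nat_mult)
    then have "real q \<le> real (order K) / r" using r by (simp add: field_simps)
    then show ?thesis using s by (intro powr_mono) auto
  qed
  finally show ?thesis .
qed

section \<open>From abundance to a single abundant graph\<close>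

lemma deletion_number_le_half:
  assumes G: "rgraph r G" and F: "edges F \<noteq> {}" and r: "r \<ge> 2"
  shows "2 * deletion_number F G \<le> order G ^ r"
proof -
  have fV: "finite (verts G)" using G by (auto simp: rgraph_def)
  have "hits F G (edges G)"
    using F by (auto simp: hits_def embs_def homs_def)
  then have "deletion_number F G \<le> card (edges G)" by (rule deletion_number_le[OF G])
  also have "\<dots> \<le> card {e. e \<subseteq> verts G \<and> card e = r}"
    using G fV by (intro card_mono) (auto simp: rgraph_def)
  also have "\<dots> = order G choose r" by (rule n_subsets[OF fV])
  finally have "2 * deletion_number F G \<le> (order G choose r) * fact r"
    using r fact_ge_self[of r] by (metis le_trans mult.commute mult_le_mono)
  also have "\<dots> \<le> order G ^ r" by (rule binomial_fact_pow)
  finally show ?thesis .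
qed

text \<open>This keeps the distance parameter away from 1, so that constant factors can later be absorbed into
  powers of it.\<close>

lemma far_parameter_le_half:
  assumes "rgraph r G" and "edges F \<noteq> {}" and "r \<ge> 2" and "order G > 0"
    and "x * real (order G) ^ r \<le> real (deletion_number F G)"
  shows "x \<le> 1 / 2"
proof -
  have "2 * (x * real (order G) ^ r) \<le> real (2 * deletion_number F G)" using assms(5) by simp
  also have "\<dots> \<le> real (order G ^ r)"
    using deletion_number_le_half[OF assms(1-3)] by (simp only: of_nat_le_iff)
  finally show ?thesis using assms(4) by (simp add: field_simps)
qed

text \<open>The blow-up of \<open>G\<close> is as far from \<open>F\<close>-free as \<open>G\<close>, arbitrarily large, and no richer in
  homomorphic images. Hence abundance, which speaks of large host graphs only, bounds homomorphism
  densities in all host graphs, with no threshold on their order.\<close>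

lemma abundant_hom_density:
  assumes ab: "abundant r F W c C" and W: "\<forall>H\<in>W. rgraph r H"
    and F: "rgraph r F" "edges F \<noteq> {}" and r: "r \<ge> 2"
    and G: "rgraph r G" "order G > 0"
    and \<epsilon>: "\<epsilon> > 0" "\<epsilon> * real (order G) ^ r \<le> real (deletion_number F G)"
  shows "\<exists>H\<in>W. c * \<epsilon> powr C \<le> hom_density (core H) G"
proof -
  have Fsub: "\<forall>e\<in>edges F. e \<subseteq> verts F" using F(1) by (auto simp: rgraph_def)
  have fV: "finite (verts G)" using G by (auto simp: rgraph_def)
  have "\<epsilon> \<le> 1" using far_parameter_le_half[OF G(1) F(2) r G(2) \<epsilon>(2)] by simp
  then obtain n0 where n0: "\<And>G. rgraph r G \<Longrightarrow> order G \<ge> n0 \<Longrightarrow> far_from_free r F \<epsilon> G \<Longrightarrow>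
      \<exists>H\<in>W. real (Emb H G) \<ge> c * \<epsilon> powr C * real (order G) ^ order H"
    using ab \<epsilon>(1) unfolding abundant_def by blast
  let ?N = "Suc n0"
  let ?B = "blow_up r G ?N"
  have B: "rgraph r ?B" using fV by (intro rgraph_tensor) auto
  have oB: "order ?B = order G * ?N" by (simp only: order_tensor hgraph.simps card_lessThan)
  have "real (deletion_number F G) > 0" 
    using \<epsilon> G(2) less_le_trans[OF mult_pos_pos[OF \<epsilon>(1), of "real (order G) ^ r"] \<epsilon>(2)] by simp
  then have "edges G \<noteq> {}"
    using deletion_number_attained[OF G(1) F(2)] by (auto simp: hits_def)
  then have "?N ^ r * deletion_number F G \<le> deletion_number F ?B"
    by (intro deletion_number_blow_up G F Fsub) auto
  then have d: "real ?N ^ r * real (deletion_number F G) \<le> real (deletion_number F ?B)"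
    by (metis of_nat_le_iff of_nat_mult of_nat_power)
  have "\<epsilon> * real (order ?B) ^ r = real ?N ^ r * (\<epsilon> * real (order G) ^ r)"
    unfolding oB of_nat_mult power_mult_distrib by (simp only: mult_ac)
  also have "\<dots> \<le> real ?N ^ r * real (deletion_number F G)"
    using \<epsilon>(2) by (intro mult_left_mono) auto
  also note d
  finally have "far_from_free r F \<epsilon> ?B" by (simp only: far_from_free_def)
  moreover have "n0 \<le> order ?B" unfolding oB using G(2) by (cases "order G") auto
  ultimately obtain H where H: "H \<in> W"
    "real (Emb H ?B) \<ge> c * \<epsilon> powr C * real (order ?B) ^ order H"
    using n0[OF B] by blast
  have rH: "rgraph r H" using W H by auto
  have fB: "finite (verts ?B)" using B by (auto simp: rgraph_def)
  have oB0: "order ?B > 0" unfolding oB using G(2) by simp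
  have "c * \<epsilon> powr C * real (order ?B) ^ order H \<le> hom_density (core H) ?B * real (order ?B) ^ order H"
    using H(2) Emb_le_hom_density_core[OF rH fB oB0] by linarith
  then have "c * \<epsilon> powr C \<le> hom_density (core H) ?B"
    using oB0 by (simp add: mult_le_cancel_right)
  also have "\<dots> \<le> hom_density (core H) G"
    by (rule hom_density_tensor_left[OF rgraph_core[OF rH] fV]) simp
  finally show ?thesis using H(1) by blast
qed

text \<open>Homomorphism densities, and no threshold on the order of the host graph: this form passes to
  products and to isomorphic graphs.\<close>

definition polynomially_abundant :: "nat \<Rightarrow> hgraph \<Rightarrow> hgraph set \<Rightarrow> bool" where
  "polynomially_abundant r F S \<longleftrightarrow> (\<exists>\<kappa>>0. \<exists>D>0. \<forall>G \<epsilon>. rgraph r G \<and> order G > 0 \<and> \<epsilon> > 0 \<and>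
     \<epsilon> * real (order G) ^ r \<le> real (deletion_number F G) \<longrightarrow>
     (\<exists>K\<in>S. \<kappa> * \<epsilon> powr D \<le> hom_density K G))"

text \<open>\<open>s\<close> disjoint copies of \<open>G\<close> are almost as far from \<open>F\<close>-free as \<open>G\<close> is: a factor
  \<open>s powr (1 - r)\<close> is lost. But they decrease the density of a graph \<open>K\<close> by a power of \<open>s\<close>
  that grows with the order of \<open>K\<close>. With \<open>s\<close> of the order \<open>\<epsilon> powr (- C)\<close> this excludes all
  \<open>K\<close> of order above \<open>r * (C + 1)\<close>.\<close>

lemma abundant_bounded_order:
  assumes ab: "abundant r F W c C" and W: "\<forall>H\<in>W. rgraph r H"
    and F: "rgraph r F" "edges F \<noteq> {}" and r: "r \<ge> 2" and c: "c > 0" and C: "C > 0"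
  shows "polynomially_abundant r F {core H |H. H \<in> W \<and> real (order (core H)) \<le> real r * (C + 1)}"
proof -
  have Fsub: "\<forall>e\<in>edges F. e \<subseteq> verts F" using F(1) by (auto simp: rgraph_def)
  define p where "p = real r - 1"
  have p: "p \<ge> 1" using r by (simp add: p_def)
  define \<kappa> where "\<kappa> = c * (3 + 1 / c) powr (- (p * C))"
  define D where "D = C + C * (p * C)"
  have "1 / c > 0" using c by simp
  then have "3 + 1 / c \<noteq> 0" by linarith
  then have \<kappa>: "\<kappa> > 0" unfolding \<kappa>_def using c by (intro mult_pos_pos) (simp_all only: powr_gt_zero not_False_eq_True)
  have D: "D > 0" using C p by (simp add: D_def add_pos_pos)
  have main: "\<exists>K\<in>{core H |H. H \<in> W \<and> real (order (core H)) \<le> real r * (C + 1)}.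
      \<kappa> * \<epsilon> powr D \<le> hom_density K G"
    if G: "rgraph r G" "order G > 0"
      and \<epsilon>: "\<epsilon> > 0" "\<epsilon> * real (order G) ^ r \<le> real (deletion_number F G)" for G \<epsilon>
  proof -
    have fV: "finite (verts G)" using G by (auto simp: rgraph_def)
    have \<epsilon>1: "\<epsilon> \<le> 1" using far_parameter_le_half[OF G(1) F(2) r G(2) \<epsilon>(2)] by simp
    define s where "s = nat \<lceil>2 + 1 / (c * \<epsilon> powr C)\<rceil>"
    have q0: "c * \<epsilon> powr C > 0" using c \<epsilon>(1) by simp
    have s_ge: "real s \<ge> 2 + 1 / (c * \<epsilon> powr C)" unfolding s_def by linarith
    have s2: "real s \<ge> 2" using s_ge divide_pos_pos[OF zero_less_one q0] by linarith
    have s_le: "real s \<le> (3 + 1 / c) * \<epsilon> powr (- C)"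
    proof -
      have "1 \<le> \<epsilon> powr (- C)"
        using \<epsilon>(1) \<epsilon>1 C powr_mono'[of "- C" 0 \<epsilon>] by simp
      moreover have "real s \<le> 3 + 1 / (c * \<epsilon> powr C)"
        using divide_pos_pos[OF zero_less_one q0] unfolding s_def by linarith
      moreover have "1 / (c * \<epsilon> powr C) = (1 / c) * \<epsilon> powr (- C)"
        using \<epsilon>(1) by (simp add: powr_minus field_simps)
      ultimately show ?thesis by (simp add: distrib_right)
    qed
    \<comment> \<open>The distance \<open>\<epsilon>\<close> of \<open>G\<close> becomes \<open>\<epsilon>' = \<epsilon> * s powr (1 - r)\<close> for \<open>s\<close> copies: their
      deletion number is at least \<open>s\<close> times as large, but they have \<open>s\<close> times the vertices.\<close>
    let ?H = "copies r G s"
    have H: "rgraph r ?H" using fV by (intro rgraph_tensor) auto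
    have oH: "order ?H = order G * s" by (simp only: order_tensor hgraph.simps) (simp add: card_image)
    have oH0: "order ?H > 0" unfolding oH using G(2) s2 by simp
    define \<epsilon>' where "\<epsilon>' = \<epsilon> * real s powr (- p)"
    have s0: "real s > 0" using s2 by simp
    have \<epsilon>'0: "\<epsilon>' > 0" using \<epsilon>(1) s0 by (simp add: \<epsilon>'_def)
    have far: "\<epsilon>' * real (order ?H) ^ r \<le> real (deletion_number F ?H)"
    proof -
      have "real s powr (- p) * real s ^ r = real s powr (- p + real r)"
        using s0 by (simp only: powr_add powr_realpow)
      also have "\<dots> = real s" using s0 by (simp add: p_def)
      finally have "\<epsilon>' * real (order ?H) ^ r = real s * (\<epsilon> * real (order G) ^ r)"
        unfolding oH by (simp add: \<epsilon>'_def power_mult_distrib mult_ac)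
      also have "\<dots> \<le> real s * real (deletion_number F G)" using \<epsilon>(2) by (intro mult_left_mono) auto
      also have "\<dots> \<le> real (deletion_number F ?H)"
        using deletion_number_copies[OF G(1) F(2) Fsub, of s] r by (simp flip: of_nat_mult)
      finally show ?thesis .
    qed
    obtain K where K: "K \<in> W" "c * \<epsilon>' powr C \<le> hom_density (core K) ?H"
      using abundant_hom_density[OF ab W F r H oH0 \<epsilon>'0 far] by blast
    have rK: "rgraph r (core K)" using K W rgraph_core by blast
    have iso: "\<forall>v\<in>verts (core K). \<exists>e\<in>edges (core K). v \<in> e" by (auto simp: core_def)
    let ?v = "real (order (core K))"
    have e': "c * \<epsilon>' powr C = c * \<epsilon> powr C * real s powr (- (p * C))"
      using \<epsilon>(1) s0 by (simp add: \<epsilon>'_def powr_mult powr_powr)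
    have "?v \<le> real r * (C + 1)"
    proof -
      have "real s powr (- 1) \<le> c * \<epsilon> powr C"
      proof -
        have "1 / (c * \<epsilon> powr C) \<le> real s" using s_ge by linarith
        then have "1 / real s \<le> c * \<epsilon> powr C" using s0 q0 by (simp add: field_simps)
        then show ?thesis using s0 by (simp add: powr_minus_divide)
      qed
      then have "real s powr (- 1) * real s powr (- (p * C)) \<le> c * \<epsilon>' powr C"
        unfolding e' by (intro mult_right_mono) auto
      also note K(2)
      also have "hom_density (core K) ?H \<le> real s powr (?v / r - ?v)"
        using r s2 by (intro hom_density_copies rK iso fV) auto
      finally have "real s powr (- 1 - p * C) \<le> real s powr (?v / r - ?v)"
        unfolding powr_add[symmetric] by simp
      then have "- 1 - p * C \<le> ?v / r - ?v" using s2 by (subst (asm) powr_le_cancel_iff) auto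
      then have "?v * p \<le> real r * (1 + p * C)" using r by (simp add: p_def field_simps)
      also have "\<dots> \<le> real r * (p + p * C)" using p by (intro mult_left_mono) auto
      also have "\<dots> = real r * (C + 1) * p" by (simp add: algebra_simps)
      finally show ?thesis using p by simp
    qed
    moreover have "\<kappa> * \<epsilon> powr D \<le> hom_density (core K) G"
    proof -
      have "((3 + 1 / c) * \<epsilon> powr (- C)) powr (- (p * C)) \<le> real s powr (- (p * C))"
        using s_le s0 p C by (intro powr_mono2') auto
      moreover have "((3 + 1 / c) * \<epsilon> powr (- C)) powr (- (p * C))
          = (3 + 1 / c) powr (- (p * C)) * \<epsilon> powr (C * (p * C))"
        using c by (simp add: powr_mult powr_powr add_nonneg_nonneg)
      ultimately have "c * \<epsilon> powr C * ((3 + 1 / c) powr (- (p * C)) * \<epsilon> powr (C * (p * C)))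
          \<le> c * \<epsilon>' powr C"
        unfolding e' using q0 by (intro mult_left_mono) auto
      moreover have "c * \<epsilon> powr C * ((3 + 1 / c) powr (- (p * C)) * \<epsilon> powr (C * (p * C))) = \<kappa> * \<epsilon> powr D"
        by (simp add: \<kappa>_def D_def powr_add)
      moreover have "hom_density (core K) ?H \<le> hom_density (core K) G"
        by (rule hom_density_tensor_left[OF rK fV]) simp
      ultimately show ?thesis using K(2) by linarith
    qed
    ultimately show ?thesis using K(1) by blast
  qed
  show ?thesis
    unfolding polynomially_abundant_def
    by (rule exI[of _ \<kappa>], rule conjI[OF \<kappa>], rule exI[of _ D], rule conjI[OF D])
      (intro allI impI, elim conjE, rule main)
qed

text \<open>Normalised by \<open>card (edges F)\<close>, lower bounds on the distance multiply along products: the factor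
  lost in \<open>deletion_number_tensor\<close> is paid by the normalisation.\<close>

lemma iterated_tensor:
  assumes F: "rgraph r F" "edges F \<noteq> {}"
    and G: "rgraph r G" "order G > 0" "x \<ge> 0"
      "real (card (edges F)) * x * real (order G) ^ r \<le> real (deletion_number F G)"
    and H: "rgraph r H" "order H > 0" "y \<ge> 0"
      "real (card (edges F)) * y * real (order H) ^ r \<le> real (deletion_number F H)"
  defines "T k \<equiv> (tensor r G ^^ k) H"
  shows "rgraph r (T k) \<and> order (T k) > 0 \<and>
    real (card (edges F)) * (x ^ k * y) * real (order (T k)) ^ r \<le> real (deletion_number F (T k)) \<and>
    (\<forall>K. rgraph r K \<longrightarrow> hom_density K (T k) \<le> hom_density K G ^ k * hom_density K H)"
proof (induction k)
  case 0
  then show ?case using H by (simp add: T_def)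
next
  case (Suc k)
  let ?m = "real (card (edges F))"
  have T: "T (Suc k) = tensor r G (T k)" by (simp add: T_def)
  have fin: "finite (verts G)" "finite (verts (T k))" using G Suc.IH by (auto simp: rgraph_def)
  have m: "?m > 0" using F finite_edges by (auto simp: card_gt_0_iff)
  have "(?m * x * real (order G) ^ r) * (?m * (x ^ k * y) * real (order (T k)) ^ r)
      \<le> real (deletion_number F G) * real (deletion_number F (T k))"
    using G H Suc.IH by (intro mult_mono) auto
  also have "\<dots> \<le> ?m * real (deletion_number F (T (Suc k)))"
    using deletion_number_tensor[OF G(1) _ F, of "T k"] Suc.IH by (simp add: T flip: of_nat_mult)
  finally have "?m * (?m * (x ^ Suc k * y) * real (order (T (Suc k))) ^ r)
      \<le> ?m * real (deletion_number F (T (Suc k)))"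
    by (simp add: T order_tensor power_mult_distrib mult_ac)
  then have "?m * (x ^ Suc k * y) * real (order (T (Suc k))) ^ r \<le> real (deletion_number F (T (Suc k)))"
    using m by (simp only: mult_le_cancel_left_pos)
  moreover have "hom_density K (T (Suc k)) \<le> hom_density K G ^ Suc k * hom_density K H"
    if K: "rgraph r K" for K
  proof -
    have "hom_density K (T (Suc k)) \<le> hom_density K G * hom_density K (T k)"
      unfolding T by (rule hom_density_tensor[OF K fin])
    also have "\<dots> \<le> hom_density K G * (hom_density K G ^ k * hom_density K H)"
      using Suc.IH K by (intro mult_left_mono hom_density_nonneg) auto
    finally show ?thesis by (simp add: mult_ac)
  qed
  moreover have "rgraph r (T (Suc k))" unfolding T by (rule rgraph_tensor[OF fin])
  moreover have "order (T (Suc k)) > 0" unfolding T order_tensor using G Suc.IH by simp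
  ultimately show ?case by blast
qed

text \<open>Two graphs that are bad for \<open>S\<close> and for \<open>S'\<close> may be bad at very different scales
  \<open>x\<close> and \<open>y\<close>. A tensor power of the first one brings the scales together up to a square;
  then the product of both is bad for \<open>S \<union> S'\<close>.\<close>

lemma no_two_bad_graphs:
  assumes F: "rgraph r F" "edges F \<noteq> {}" and r: "r \<ge> 2"
    and SS: "\<forall>K\<in>S \<union> S'. rgraph r K"
    and ab: "\<And>G x. rgraph r G \<Longrightarrow> order G > 0 \<Longrightarrow> x > 0 \<Longrightarrow>
      real (card (edges F)) * x * real (order G) ^ r \<le> real (deletion_number F G) \<Longrightarrow>
      \<exists>K\<in>S \<union> S'. x powr D \<le> hom_density K G"
    and D: "D > 0"
    and G: "rgraph r G" "order G > 0" "x > 0"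
      "real (card (edges F)) * x * real (order G) ^ r \<le> real (deletion_number F G)"
    and H: "rgraph r H" "order H > 0" "y > 0"
      "real (card (edges F)) * y * real (order H) ^ r \<le> real (deletion_number F H)"
    and xy: "y \<le> x" "x < 1"
    and badG: "\<forall>K\<in>S. hom_density K G < x powr (3 * D)"
    and badH: "\<forall>K\<in>S'. hom_density K H < y powr (3 * D)"
  shows False
proof -
  \<comment> \<open>The least power of \<open>x\<close> that does not exceed \<open>y\<close> is still at least \<open>y ^ 2\<close>.\<close>
  have ex: "\<exists>k. x ^ k \<le> y"
    using real_arch_pow_inv[OF H(3) xy(2)] by (meson less_imp_le)
  define k where "k = (LEAST k. x ^ k \<le> y)"
  have k: "x ^ k \<le> y" unfolding k_def using ex by (rule LeastI_ex)
  then have "k \<noteq> 0" using xy by (cases k) auto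
  then obtain j where j: "k = Suc j" by (cases k) auto
  have "\<not> x ^ j \<le> y" using not_less_Least[of j "\<lambda>k. x ^ k \<le> y"] j unfolding k_def by simp
  then have "y * y \<le> x * x ^ j" using xy H(3) by (intro mult_mono) auto
  then have yk: "y ^ 3 \<le> x ^ k * y" using H(3) by (simp add: j power3_eq_cube mult_right_mono)
  define T where "T = (tensor r G ^^ k) H"
  have T: "rgraph r T" "order T > 0"
    "real (card (edges F)) * (x ^ k * y) * real (order T) ^ r \<le> real (deletion_number F T)"
    "\<And>K. rgraph r K \<Longrightarrow> hom_density K T \<le> hom_density K G ^ k * hom_density K H"
    using iterated_tensor[OF F G(1,2) _ G(4) H(1,2) _ H(4), of k] G(3) H(3) by (auto simp: T_def)
  have fin: "finite (verts G)" "finite (verts H)" using G H by (auto simp: rgraph_def)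
  obtain K where K: "K \<in> S \<union> S'" "(x ^ k * y) powr D \<le> hom_density K T"
    using ab[OF T(1,2) _ T(3)] G(3) H(3) by auto
  have rK: "rgraph r K" using K SS by blast
  have pw: "(z ^ n) powr E = z powr (real n * E)" if "z > 0" for z E :: real and n
    unfolding powr_realpow[OF that, symmetric] powr_powr ..
  have "y powr (3 * D) = (y ^ 3) powr D" by (simp add: pw[OF H(3)])
  also have "\<dots> \<le> (x ^ k * y) powr D" using yk H(3) D by (intro powr_mono2) auto
  finally have low: "y powr (3 * D) \<le> hom_density K G ^ k * hom_density K H"
    using K(2) T(4)[OF rK] by linarith
  show False
  proof (cases "K \<in> S'")
    case True
    have "hom_density K G ^ k * hom_density K H \<le> 1 * hom_density K H"
      by (intro mult_right_mono power_le_one hom_density_nonneg hom_density_le_1[OF rK fin(1)])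
    then show False using low badH True by fastforce
  next
    case False
    have "hom_density K G ^ k * hom_density K H \<le> hom_density K G ^ k * 1"
      by (intro mult_left_mono zero_le_power hom_density_nonneg hom_density_le_1[OF rK fin(2)])
    moreover have "hom_density K G ^ k < (x powr (3 * D)) ^ k"
      using badG K False \<open>k \<noteq> 0\<close> by (intro power_strict_mono hom_density_nonneg) auto
    moreover have "(x powr (3 * D)) ^ k = (x ^ k) powr (3 * D)"
      using G(3) by (simp add: pw powr_power mult.commute)
    moreover have "(x ^ k) powr (3 * D) \<le> y powr (3 * D)"
      using k G(3) D by (intro powr_mono2) auto
    ultimately show False using low by linarith
  qed
qed

text \<open>If neither part is abundant, each has a bad graph for the exponent \<open>3 * D\<close>, where \<open>D\<close> is
  an exponent that works for the union. The factor 3 covers the loss in \<open>no_two_bad_graphs\<close>, where the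
  product has distance at least the cube of the smaller of the two distances.\<close>

lemma polynomially_abundant_Un:
  assumes F: "rgraph r F" "edges F \<noteq> {}" and r: "r \<ge> 2"
    and SS: "\<forall>K\<in>S \<union> S'. rgraph r K"
    and ab: "polynomially_abundant r F (S \<union> S')"
  shows "polynomially_abundant r F S \<or> polynomially_abundant r F S'"
proof (rule ccontr)
  assume neg: "\<not> ?thesis"
  let ?m = "real (card (edges F))"
  let ?far = "\<lambda>x G. rgraph r G \<and> order G > 0 \<and> x > 0 \<and>
    ?m * x * real (order G) ^ r \<le> real (deletion_number F G)"
  have "card (edges F) > 0" using F finite_edges by (auto simp: card_gt_0_iff)
  then have m: "?m \<ge> 1" and "?m > 0" by auto
  obtain \<kappa> D0 where \<kappa>: "\<kappa> > 0" "D0 > 0" and ab':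
    "\<And>G \<epsilon>. rgraph r G \<Longrightarrow> order G > 0 \<Longrightarrow> \<epsilon> > 0 \<Longrightarrow>
      \<epsilon> * real (order G) ^ r \<le> real (deletion_number F G) \<Longrightarrow>
      \<exists>K\<in>S \<union> S'. \<kappa> * \<epsilon> powr D0 \<le> hom_density K G"
    using ab unfolding polynomially_abundant_def by blast
  have half: "x \<le> 1 / 2" if "?far x G" for x G
  proof -
    have "?m * x \<le> 1 / 2" using that F r by (intro far_parameter_le_half[of r G F]) auto
    moreover have "1 * x \<le> ?m * x" using m that by (intro mult_right_mono) auto
    ultimately show ?thesis by simp
  qed
  obtain q where q: "(1 / 2 :: real) ^ q < \<kappa>"
    using real_arch_pow_inv[OF \<kappa>(1), of "1 / 2"] by auto
  define D where "D = D0 + real q"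
  have D: "D > 0" using \<kappa> by (simp add: D_def)
  \<comment> \<open>As \<open>x\<close> is at most one half, a constant factor can be traded for a larger exponent.\<close>
  have abx: "\<exists>K\<in>S \<union> S'. x powr D \<le> hom_density K G" if far: "?far x G" for G x
  proof -
    have x: "0 < x" "x \<le> 1 / 2" using far half by auto
    have "?m * x > 0" using x(1) \<open>?m > 0\<close> by (rule mult_pos_pos[rotated])
    then have "\<exists>K\<in>S \<union> S'. \<kappa> * (?m * x) powr D0 \<le> hom_density K G"
      using far by (intro ab') auto
    then obtain K where K: "K \<in> S \<union> S'" "\<kappa> * (?m * x) powr D0 \<le> hom_density K G"
      by blast
    have "x powr D = x ^ q * x powr D0" using x by (simp add: D_def powr_add powr_realpow)
    also have "\<dots> \<le> \<kappa> * (?m * x) powr D0"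
    proof (rule mult_mono)
      show "x ^ q \<le> \<kappa>" using power_mono[OF x(2), of q] x(1) q by linarith
      show "x powr D0 \<le> (?m * x) powr D0"
        using x m \<kappa>(2) mult_right_mono[OF m, of x] by (intro powr_mono2) auto
    qed (use x \<kappa> in auto)
    finally show ?thesis using K by force
  qed
  have bad: "\<exists>G x. ?far x G \<and> (\<forall>K\<in>U. hom_density K G < x powr (3 * D))"
    if "\<not> polynomially_abundant r F U" for U
  proof -
    have "?m powr (- (3 * D)) > 0" "3 * D > 0" using m D by auto
    then have "\<not> (\<forall>G \<epsilon>. rgraph r G \<and> order G > 0 \<and> \<epsilon> > 0 \<and>
        \<epsilon> * real (order G) ^ r \<le> real (deletion_number F G) \<longrightarrow>
        (\<exists>K\<in>U. ?m powr (- (3 * D)) * \<epsilon> powr (3 * D) \<le> hom_density K G))"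
      using that unfolding polynomially_abundant_def by blast
    then obtain G \<epsilon> where G: "rgraph r G" "order G > 0" "\<epsilon> > 0"
      "\<epsilon> * real (order G) ^ r \<le> real (deletion_number F G)"
      "\<forall>K\<in>U. hom_density K G < ?m powr (- (3 * D)) * \<epsilon> powr (3 * D)"
      unfolding not_all not_imp bex_simps(8) not_le by auto
    have "(\<epsilon> / ?m) powr (3 * D) = ?m powr (- (3 * D)) * \<epsilon> powr (3 * D)"
      using G(3) m by (simp add: powr_divide powr_minus field_simps)
    then have "?far (\<epsilon> / ?m) G \<and> (\<forall>K\<in>U. hom_density K G < (\<epsilon> / ?m) powr (3 * D))"
      using G m by simp
    then show ?thesis by blast
  qed
  obtain G x where G: "?far x G" "\<forall>K\<in>S. hom_density K G < x powr (3 * D)" using bad neg by blast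
  obtain H y where H: "?far y H" "\<forall>K\<in>S'. hom_density K H < y powr (3 * D)" using bad neg by blast
  have xy: "x < 1" "y < 1" using half[OF G(1)] half[OF H(1)] by auto
  show False
  proof (cases "y \<le> x")
    case True
    show False
      by (rule no_two_bad_graphs[OF F r SS _ D, of G x H y]) (use abx G H True xy in auto)
  next
    case False
    show False
      by (rule no_two_bad_graphs[of r F S' S D H y G x]) (use F r SS D abx G H False xy in \<open>auto simp: Un_commute\<close>)
  qed
qed

text \<open>\<open>F\<close> itself is a graph at positive distance from \<open>F\<close>-free.\<close>

lemma not_polynomially_abundant_empty:
  assumes F: "rgraph r F" "edges F \<noteq> {}" and r: "r \<ge> 2"
  shows "\<not> polynomially_abundant r F {}"
proof
  assume "polynomially_abundant r F {}"
  then obtain \<kappa> D where *: "\<And>G \<epsilon>. rgraph r G \<Longrightarrow> order G > 0 \<Longrightarrow> \<epsilon> > 0 \<Longrightarrow>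
      \<epsilon> * real (order G) ^ r \<le> real (deletion_number F G) \<Longrightarrow>
      \<exists>K\<in>({}::hgraph set). \<kappa> * \<epsilon> powr D \<le> hom_density K G"
    unfolding polynomially_abundant_def by blast
  obtain e where e: "e \<in> edges F" using F by auto
  have fin: "finite (verts F)" and "e \<subseteq> verts F" "card e = r" using F e by (auto simp: rgraph_def)
  then have "r \<le> order F" using card_mono[OF fin, of e] by simp
  then have o: "order F > 0" using r by linarith
  have Fsub: "e \<subseteq> verts F" if "e \<in> edges F" for e using F that by (auto simp: rgraph_def)
  have img: "restrict id (verts F) ` e = e" if "e \<in> edges F" for e using Fsub[OF that] by force
  have "\<forall>e\<in>edges F. restrict id (verts F) ` e \<in> edges F" using img by metis
  then have "restrict id (verts F) \<in> embs F F"
    unfolding embs_def homs_def by (simp add: inj_on_def)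
  moreover obtain X where X: "hits F F X" "card X = deletion_number F F"
    using deletion_number_attained F by blast
  ultimately have "X \<noteq> {}" unfolding hits_def by blast
  moreover have "finite X" using X(1) finite_edges[OF F(1)] finite_subset by (auto simp: hits_def)
  ultimately have "deletion_number F F > 0" unfolding X(2)[symmetric] by (simp add: card_gt_0_iff)
  then have "real (deletion_number F F) / real (order F) ^ r > 0" using o by simp
  from *[OF F(1) o this] o show False by simp
qed

lemma polynomially_abundant_finite:
  assumes F: "rgraph r F" "edges F \<noteq> {}" and r: "r \<ge> 2"
    and "finite S" and "\<forall>K\<in>S. rgraph r K" and "polynomially_abundant r F S"
  shows "\<exists>K\<in>S. polynomially_abundant r F {K}"
  using assms(4-6)
proof (induction S)
  case empty
  then show ?case using not_polynomially_abundant_empty[OF F r] by simp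
next
  case (insert K S)
  then have "polynomially_abundant r F {K} \<or> polynomially_abundant r F S"
    by (intro polynomially_abundant_Un[OF F r]) auto
  then show ?case using insert by auto
qed

lemma hom_density_isomorphic:
  assumes K: "rgraph r K" and f: "bij_betw f (verts K) (verts L)" "edges L = (`) f ` edges K"
    and G: "finite (verts G)"
  shows "rgraph r L" and "hom_density K G \<le> hom_density L G"
proof -
  have Ksub: "e \<subseteq> verts K" "card e = r" if "e \<in> edges K" for e
    using K that by (auto simp: rgraph_def)
  have inj: "inj_on f (verts K)" and im: "f ` verts K = verts L" using f by (auto simp: bij_betw_def)
  have "finite (verts K)" using K by (auto simp: rgraph_def)
  then show L: "rgraph r L"
    unfolding rgraph_def f(2) im[symmetric]
    using Ksub inj_on_subset[OF inj] by (auto simp: card_image)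
  let ?g = "inv_into (verts K) f"
  have gf: "?g (f v) = v" if "v \<in> verts K" for v using inj that by simp
  have "card (homs K G) \<le> card (homs L G)"
  proof (rule card_inj_on_le[where f = "\<lambda>\<phi>. restrict (\<phi> \<circ> ?g) (verts L)"])
    show "inj_on (\<lambda>\<phi>. restrict (\<phi> \<circ> ?g) (verts L)) (homs K G)"
    proof (rule inj_onI)
      fix \<phi> \<psi> assume *: "\<phi> \<in> homs K G" "\<psi> \<in> homs K G"
        "restrict (\<phi> \<circ> ?g) (verts L) = restrict (\<psi> \<circ> ?g) (verts L)"
      have "\<phi> v = \<psi> v" if "v \<in> verts K" for v
        using fun_cong[OF *(3), of "f v"] that im gf[OF that] by force
      then show "\<phi> = \<psi>" using * by (auto simp: homs_def intro: PiE_ext)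
    qed
    show "(\<lambda>\<phi>. restrict (\<phi> \<circ> ?g) (verts L)) ` homs K G \<subseteq> homs L G"
    proof
      fix \<psi> assume "\<psi> \<in> (\<lambda>\<phi>. restrict (\<phi> \<circ> ?g) (verts L)) ` homs K G"
      then obtain \<phi> where \<phi>: "\<phi> \<in> homs K G" and \<psi>: "\<psi> = restrict (\<phi> \<circ> ?g) (verts L)" by auto
      have "\<psi> ` f ` e = \<phi> ` e" if "e \<in> edges K" for e
      proof -
        have "\<psi> (f v) = \<phi> v" if "v \<in> e" for v
          using Ksub(1)[OF \<open>e \<in> edges K\<close>] that im gf by (auto simp: \<psi>)
        then show ?thesis by (force simp: image_image)
      qed
      moreover have "\<psi> \<in> verts L \<rightarrow>\<^sub>E verts G"
        using \<phi> inv_into_into[of _ f "verts K"] im by (auto simp: \<psi> homs_def)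
      ultimately show "\<psi> \<in> homs L G" using \<phi> by (auto simp: homs_def f(2))
    qed
  qed (rule finite_homs[OF L G])
  moreover have "order K = order L" using f by (auto dest: bij_betw_same_card)
  ultimately show "hom_density K G \<le> hom_density L G"
    by (auto simp: hom_density_def intro!: divide_right_mono)
qed

text \<open>Up to isomorphism there are only finitely many cores of bounded order; representatives on the
  vertex sets \<open>{..<v}\<close> make this a finite family, from which all but one graph can be discarded.\<close>

theorem ex_abundant_core:
  assumes ab: "abundant r F W c C" and W: "\<forall>H\<in>W. rgraph r H"
    and F: "rgraph r F" "edges F \<noteq> {}" and r: "r \<ge> 2" and c: "c > 0" and C: "C > 0"
  obtains H L f where "H \<in> W" and "real (order (core H)) \<le> real r * (C + 1)"
    and "bij_betw f (verts (core H)) (verts L)" and "edges L = (`) f ` edges H"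
    and "verts L = {..<order (core H)}" and "rgraph r L" and "polynomially_abundant r F {L}"
proof -
  let ?ok = "\<lambda>H. H \<in> W \<and> real (order (core H)) \<le> real r * (C + 1)"
  define iso where "iso H L \<longleftrightarrow> verts L = {..<order (core H)} \<and>
    (\<exists>f. bij_betw f (verts (core H)) (verts L) \<and> edges L = (`) f ` edges H)" for H L :: hgraph
  define S where "S = {L. \<exists>H. ?ok H \<and> iso H L}"
  have rc: "rgraph r (core H)" if "H \<in> W" for H using W that rgraph_core by blast
  have rL: "rgraph r L" if "H \<in> W" "iso H L" for H L
    using hom_density_isomorphic(1)[of r "core H" _ L "\<lparr>verts = {}, edges = {}\<rparr>"] rc that
    by (auto simp: iso_def)
  have "finite S"
  proof (rule finite_subset)
    let ?b = "nat \<lfloor>real r * (C + 1)\<rfloor>"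
    show "S \<subseteq> (\<lambda>(n, E). \<lparr>verts = {..<n}, edges = E\<rparr>) ` ({..?b} \<times> Pow (Pow {..<?b}))"
    proof
      fix L assume "L \<in> S"
      then obtain H where H: "?ok H" "iso H L" by (auto simp: S_def)
      have n: "order (core H) \<le> ?b" using H(1) by linarith
      have v: "verts L = {..<order (core H)}" using H(2) by (simp add: iso_def)
      moreover have "edges L \<subseteq> Pow {..<?b}"
        using rL[of H L] H n v by (fastforce simp: rgraph_def)
      ultimately have "L = (\<lambda>(n, E). \<lparr>verts = {..<n}, edges = E\<rparr>) (order (core H), edges L)"
        "(order (core H), edges L) \<in> {..?b} \<times> Pow (Pow {..<?b})"
        using n by auto
      then show "L \<in> (\<lambda>(n, E). \<lparr>verts = {..<n}, edges = E\<rparr>) ` ({..?b} \<times> Pow (Pow {..<?b}))"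
        by (rule image_eqI)
    qed
  qed auto
  moreover have "\<forall>L\<in>S. rgraph r L" using rL by (auto simp: S_def)
  moreover have "polynomially_abundant r F S"
  proof -
    obtain \<kappa> D where \<kappa>: "\<kappa> > 0" "D > 0" and *: "\<And>G \<epsilon>. rgraph r G \<Longrightarrow> order G > 0 \<Longrightarrow> \<epsilon> > 0 \<Longrightarrow>
        \<epsilon> * real (order G) ^ r \<le> real (deletion_number F G) \<Longrightarrow>
        \<exists>K\<in>{core H |H. ?ok H}. \<kappa> * \<epsilon> powr D \<le> hom_density K G"
      using abundant_bounded_order[OF assms] unfolding polynomially_abundant_def by blast
    have "\<exists>L\<in>S. \<kappa> * \<epsilon> powr D \<le> hom_density L G" if G: "rgraph r G" "order G > 0" "\<epsilon> > 0"
      "\<epsilon> * real (order G) ^ r \<le> real (deletion_number F G)" for G \<epsilon>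
    proof -
      obtain H where H: "?ok H" "\<kappa> * \<epsilon> powr D \<le> hom_density (core H) G" using *[OF G] by blast
      have "finite (verts (core H))" using rc H(1) by (auto simp: rgraph_def)
      then obtain f where f: "bij_betw f (verts (core H)) {..<order (core H)}"
        using finite_same_card_bij[of "verts (core H)" "{..<order (core H)}"] by auto
      define L where "L = \<lparr>verts = {..<order (core H)}, edges = (`) f ` edges H\<rparr>"
      have "iso H L" using f by (auto simp: iso_def L_def)
      moreover have "hom_density (core H) G \<le> hom_density L G"
        using f rc H(1) G(1) by (intro hom_density_isomorphic(2)[of r _ f]) (auto simp: L_def rgraph_def)
      ultimately have "L \<in> S" "\<kappa> * \<epsilon> powr D \<le> hom_density L G"
        using H(1) H(2) unfolding S_def by (blast, linarith)
      then show ?thesis by blast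
    qed
    then show ?thesis unfolding polynomially_abundant_def using \<kappa> by blast
  qed
  ultimately obtain L where "L \<in> S" "polynomially_abundant r F {L}"
    using polynomially_abundant_finite[OF F r] by blast
  then obtain H where H: "?ok H" "iso H L" by (auto simp: S_def)
  then obtain f where "bij_betw f (verts (core H)) (verts L)" "edges L = (`) f ` edges H"
    by (auto simp: iso_def)
  then show thesis
    using that[of H f L] H rL[of H L] \<open>polynomially_abundant r F {L}\<close> unfolding iso_def by blast
qed

section \<open>Closure properties of the recursive functions\<close>

lemma recursive_cong: "recursive f \<Longrightarrow> (\<And>xs. f xs = g xs) \<Longrightarrow> recursive g"
  using ext[of f g] by simp

lemma recursive_comp1: "recursive f \<Longrightarrow> recursive g \<Longrightarrow> recursive (\<lambda>xs. f [g xs])"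
  using recursive.comp[of f "[g]"] by simp

lemma recursive_comp2:
  "recursive f \<Longrightarrow> recursive g \<Longrightarrow> recursive h \<Longrightarrow> recursive (\<lambda>xs. f [g xs, h xs])"
  using recursive.comp[of f "[g, h]"] by simp

lemma recursive_Suc: "recursive f \<Longrightarrow> recursive (\<lambda>xs. Suc (f xs))"
  using recursive_comp1[OF recursive.succ, of f] by (simp add: arg_def)

lemma recursive_const: "recursive (\<lambda>xs. c)"
  by (induction c) (simp_all add: recursive.zero recursive_Suc)

lemma recursive_add:
  assumes "recursive f" and "recursive g"
  shows "recursive (\<lambda>xs. f xs + g xs)"
proof -
  have eq: "rec_nat b (\<lambda>k y. Suc y) a = a + b" for a b :: nat by (induction a) auto
  have "recursive (\<lambda>xs. rec_nat (arg 0 (tl xs)) (\<lambda>k y. Suc (arg 1 (k # y # tl xs))) (arg 0 xs))"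
    by (rule recursive.prim[OF recursive.proj recursive_Suc[OF recursive.proj]])
  from recursive_comp2[OF this assms] show ?thesis by (simp add: arg_def eq)
qed

lemma recursive_mult:
  assumes "recursive f" and "recursive g"
  shows "recursive (\<lambda>xs. f xs * g xs)"
proof -
  have eq: "rec_nat 0 (\<lambda>k y. y + b) a = a * b" for a b :: nat by (induction a) auto
  have "recursive (\<lambda>xs. rec_nat 0 (\<lambda>k y. arg 1 (k # y # tl xs) + arg 2 (k # y # tl xs)) (arg 0 xs))"
    by (rule recursive.prim[OF recursive.zero recursive_add[OF recursive.proj recursive.proj]])
  from recursive_comp2[OF this assms] show ?thesis by (simp add: arg_def eq)
qed

lemma recursive_diff:
  assumes "recursive f" and "recursive g"
  shows "recursive (\<lambda>xs. f xs - g xs)"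
proof -
  have pred: "rec_nat 0 (\<lambda>k y. k) a = a - 1" for a :: nat by (cases a) auto
  have p: "recursive (\<lambda>xs. rec_nat 0 (\<lambda>k y. arg 0 (k # y # tl xs)) (arg 0 xs))"
    by (rule recursive.prim[OF recursive.zero recursive.proj])
  have pr: "recursive (\<lambda>xs. h xs - 1)" if "recursive h" for h
    using recursive_comp1[OF p that] by (simp add: arg_def pred[simplified])
  have eq: "rec_nat a (\<lambda>k y. y - 1) b = a - b" for a b :: nat by (induction b) auto
  have "recursive (\<lambda>xs. rec_nat (arg 0 (tl xs)) (\<lambda>k y. arg 1 (k # y # tl xs) - 1) (arg 0 xs))"
    by (rule recursive.prim[OF recursive.proj pr[OF recursive.proj]])
  from recursive_comp2[OF this assms(2,1)] show ?thesis by (simp add: arg_def eq[simplified])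
qed

lemma recursive_power:
  assumes "recursive f" and "recursive g"
  shows "recursive (\<lambda>xs. f xs ^ g xs)"
proof -
  have eq: "rec_nat (Suc 0) (\<lambda>k y. y * b) a = b ^ a" for a b :: nat by (induction a) auto
  have "recursive (\<lambda>xs. rec_nat (Suc 0) (\<lambda>k y. arg 1 (k # y # tl xs) * arg 2 (k # y # tl xs)) (arg 0 xs))"
    by (rule recursive.prim[OF recursive_const recursive_mult[OF recursive.proj recursive.proj]])
  from recursive_comp2[OF this assms(2,1)] show ?thesis by (simp add: arg_def eq)
qed

definition recursive_pred :: "(nat list \<Rightarrow> bool) \<Rightarrow> bool" where
  "recursive_pred Q \<longleftrightarrow> recursive (\<lambda>xs. if Q xs then 1 else 0)"

lemma recursive_pred_const: "recursive_pred (\<lambda>xs. b)"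
  unfolding recursive_pred_def by (rule recursive_const)

lemma recursive_pred_le:
  assumes "recursive f" and "recursive g"
  shows "recursive_pred (\<lambda>xs. f xs \<le> g xs)"
proof -
  have "recursive (\<lambda>xs. 1 - (f xs - g xs))"
    using assms by (intro recursive_diff recursive_const)
  moreover have "1 - (f xs - g xs) = (if f xs \<le> g xs then 1 else 0)" for xs by auto
  ultimately show ?thesis unfolding recursive_pred_def by (rule recursive_cong)
qed

lemma recursive_pred_not:
  assumes "recursive_pred Q"
  shows "recursive_pred (\<lambda>xs. \<not> Q xs)"
proof -
  have "recursive (\<lambda>xs. 1 - (if Q xs then 1 else 0))"
    using assms unfolding recursive_pred_def by (intro recursive_diff recursive_const)
  moreover have "1 - (if Q xs then 1 else 0) = (if \<not> Q xs then 1 else 0 :: nat)" for xs by auto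
  ultimately show ?thesis unfolding recursive_pred_def by (rule recursive_cong)
qed

lemma recursive_pred_conj:
  assumes "recursive_pred Q" and "recursive_pred R"
  shows "recursive_pred (\<lambda>xs. Q xs \<and> R xs)"
proof -
  have "recursive (\<lambda>xs. (if Q xs then 1 else 0) * (if R xs then 1 else 0))"
    using assms unfolding recursive_pred_def by (rule recursive_mult)
  moreover have "(if Q xs then 1 else 0) * (if R xs then 1 else 0)
      = (if Q xs \<and> R xs then 1 else 0 :: nat)" for xs by auto
  ultimately show ?thesis unfolding recursive_pred_def by (rule recursive_cong)
qed

lemma recursive_pred_disj:
  "recursive_pred Q \<Longrightarrow> recursive_pred R \<Longrightarrow> recursive_pred (\<lambda>xs. Q xs \<or> R xs)"
  using recursive_pred_not[OF recursive_pred_conj[OF recursive_pred_not recursive_pred_not], of Q R]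
  by simp

lemma recursive_pred_less:
  "recursive f \<Longrightarrow> recursive g \<Longrightarrow> recursive_pred (\<lambda>xs. f xs < g xs)"
  using recursive_pred_not[OF recursive_pred_le, of g f] by (simp add: not_le)

lemma recursive_pred_eq:
  "recursive f \<Longrightarrow> recursive g \<Longrightarrow> recursive_pred (\<lambda>xs. f xs = g xs)"
  using recursive_pred_conj[OF recursive_pred_le recursive_pred_le, of f g g f]
  by (simp add: order.eq_iff)

lemma recursive_pred_ball:
  assumes "finite I" and "\<And>i. i \<in> I \<Longrightarrow> recursive_pred (Q i)"
  shows "recursive_pred (\<lambda>xs. \<forall>i\<in>I. Q i xs)"
  using assms
  by (induction I) (auto simp: recursive_pred_const intro: recursive_pred_conj)

lemma recursive_pred_bex:
  assumes "finite I" and "\<And>i. i \<in> I \<Longrightarrow> recursive_pred (Q i)"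
  shows "recursive_pred (\<lambda>xs. \<exists>i\<in>I. Q i xs)"
  using assms
  by (induction I) (auto simp: recursive_pred_const intro: recursive_pred_disj)

lemma recursive_if:
  assumes "recursive_pred Q" and "recursive f" and "recursive g"
  shows "recursive (\<lambda>xs. if Q xs then f xs else g xs)"
proof -
  have "recursive (\<lambda>xs. (if Q xs then 1 else 0) * f xs + (if \<not> Q xs then 1 else 0) * g xs)"
    using assms recursive_pred_not[OF assms(1)] unfolding recursive_pred_def
    by (intro recursive_add recursive_mult)
  moreover have "(if Q xs then 1 else 0) * f xs + (if \<not> Q xs then 1 else 0) * g xs
      = (if Q xs then f xs else g xs)" for xs by auto
  ultimately show ?thesis by (rule recursive_cong)
qed

lemma recursive_sum:
  assumes "finite I" and "\<And>i. i \<in> I \<Longrightarrow> recursive (f i)"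
  shows "recursive (\<lambda>xs. \<Sum>i\<in>I. f i xs)"
  using assms by (induction I) (auto simp: recursive_const intro: recursive_add)

text \<open>Minimisation finds the quotient. The search stops at 0 if the divisor is 0, which keeps it
  total and agrees with \<open>a div 0 = 0\<close>.\<close>

lemma recursive_div:
  assumes "recursive f" and "recursive g"
  shows "recursive (\<lambda>xs. f xs div g xs)"
proof -
  let ?Q = "\<lambda>xs. arg 2 xs = 0 \<or> arg 1 xs < Suc (arg 0 xs) * arg 2 xs"
  let ?h = "\<lambda>xs. if ?Q xs then 0 else 1 :: nat"
  have h: "recursive ?h"
    by (intro recursive_if recursive_pred_disj recursive_pred_eq recursive_pred_less recursive_const
        recursive.proj recursive_mult recursive_Suc)
  have ex: "\<forall>xs. \<exists>y. ?h (y # xs) = 0"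
  proof
    fix xs
    have "?Q (arg 0 xs # xs)" by (cases "arg 1 xs") (auto simp: arg_def)
    then show "\<exists>y. ?h (y # xs) = 0" by metis
  qed
  have eq: "(LEAST y. ?h (y # [a, b]) = 0) = a div b" for a b
  proof (rule Least_equality)
    show "?h ((a div b) # [a, b]) = 0"
      using dividend_less_div_times[of b a] by (auto simp: arg_def)
    show "a div b \<le> y" if "?h (y # [a, b]) = 0" for y
      using that less_mult_imp_div_less[of a "Suc y" b] by (auto simp: arg_def split: if_splits)
  qed
  show ?thesis
    using recursive_comp2[OF recursive.mini[OF h ex] assms] unfolding eq .
qed

lemma recursive_mod:
  assumes "recursive f" and "recursive g"
  shows "recursive (\<lambda>xs. f xs mod g xs)"
  using recursive_diff[OF assms(1) recursive_mult[OF assms(2) recursive_div[OF assms]]]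
  by (simp add: minus_mult_div_eq_mod)

lemmas recursive_intros = recursive_const recursive.proj recursive_add recursive_mult recursive_diff
  recursive_power recursive_div recursive_mod recursive_sum recursive_if recursive_pred_const
  recursive_pred_le recursive_pred_less recursive_pred_eq recursive_pred_not recursive_pred_conj
  recursive_pred_disj recursive_pred_ball recursive_pred_bex

text \<open>Arbitrary behaviour on finitely many argument values is recursive; this will cover all inputs
  with few vertices at once.\<close>

lemma recursive_table:
  assumes "finite S"
  shows "recursive (\<lambda>xs. if (arg i xs, arg j xs, arg k xs) \<in> S then h (arg i xs, arg j xs, arg k xs) else 0)"
proof -
  have "recursive (\<lambda>xs. \<Sum>p\<in>S. if arg i xs = fst p \<and> arg j xs = fst (snd p) \<and> arg k xs = snd (snd p)
      then h p else 0)"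
    using assms by (intro recursive_intros)
  moreover have "(\<Sum>p\<in>S. if arg i xs = fst p \<and> arg j xs = fst (snd p) \<and> arg k xs = snd (snd p)
      then h p else 0) = (if (arg i xs, arg j xs, arg k xs) \<in> S then h (arg i xs, arg j xs, arg k xs) else 0)" for xs
  proof -
    have "(\<Sum>p\<in>S. if arg i xs = fst p \<and> arg j xs = fst (snd p) \<and> arg k xs = snd (snd p) then h p else 0)
        = (\<Sum>p\<in>S. if (arg i xs, arg j xs, arg k xs) = p then h p else 0)"
      by (intro sum.cong) auto
    then show ?thesis using assms by simp
  qed
  ultimately show ?thesis by (rule recursive_cong)
qed

section \<open>Counting embeddings and seeds\<close>

text \<open>A homomorphism that is not injective identifies two vertices; this costs one degree of freedom.\<close>

lemma card_homs_le_embs: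
  assumes L: "rgraph r L" and G: "finite (verts G)"
  shows "card (homs L G) \<le> card (embs L G) + order L ^ 2 * order G ^ (order L - 1)"
proof -
  let ?V = "verts L"
  have fV: "finite ?V" using L by (auto simp: rgraph_def)
  have fH: "finite (homs L G)" by (rule finite_homs[OF L G])
  let ?A = "\<lambda>(i, j). {\<phi> \<in> homs L G. i \<noteq> j \<and> \<phi> i = \<phi> j}"
  have "homs L G \<subseteq> embs L G \<union> (\<Union>p\<in>?V \<times> ?V. ?A p)"
    by (auto simp: embs_def inj_on_def)
  then have "card (homs L G) \<le> card (embs L G \<union> (\<Union>p\<in>?V \<times> ?V. ?A p))"
    using fV fH finite_embs[OF L G] by (intro card_mono) auto
  also have "\<dots> \<le> card (embs L G) + card (\<Union>p\<in>?V \<times> ?V. ?A p)" by (rule card_Un_le)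
  also have "card (\<Union>p\<in>?V \<times> ?V. ?A p) \<le> (\<Sum>p\<in>?V \<times> ?V. card (?A p))"
    using fV by (intro card_UN_le) auto
  also have "\<dots> \<le> (\<Sum>p\<in>?V \<times> ?V. order G ^ (order L - 1))"
  proof (rule sum_mono)
    fix p assume "p \<in> ?V \<times> ?V"
    then obtain i j where p: "p = (i, j)" "i \<in> ?V" "j \<in> ?V" by auto
    have "card (?A p) \<le> order G ^ (order L - card {i})"
      unfolding p(1) by (rule card_PiE_agreeing[OF fV G]) (use p in \<open>auto simp: homs_def\<close>)
    then show "card (?A p) \<le> order G ^ (order L - 1)" by simp
  qed
  also have "\<dots> = order L ^ 2 * order G ^ (order L - 1)"
    by (simp add: card_cartesian_product power2_eq_square)
  finally show ?thesis by simp
qed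

text \<open>In host graphs of order at least \<open>2 * v ^ 2 / \<delta>\<close> the non-injective homomorphisms are at most half
  of all, so homomorphism densities become embedding densities.\<close>

lemma card_embs_ge:
  assumes L: "rgraph r L" "order L > 0" and G: "finite (verts G)" "order G > 0"
    and \<delta>: "\<delta> \<le> hom_density L G" and large: "2 * real (order L) ^ 2 \<le> \<delta> * real (order G)"
  shows "\<delta> / 2 * real (order G) ^ order L \<le> real (card (embs L G))"
proof -
  let ?n = "real (order G)"
  have pw: "?n ^ order L = ?n * ?n ^ (order L - 1)"
    using L(2) by (simp add: power_eq_if)
  have "\<delta> * ?n ^ order L \<le> real (card (homs L G))"
    using \<delta> G(2) by (simp add: hom_density_def field_simps)
  also have "\<dots> \<le> real (card (embs L G)) + real (order L) ^ 2 * ?n ^ (order L - 1)"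
    using of_nat_mono[OF card_homs_le_embs[OF L(1) G(1)], where ?'a = real] by simp
  also have "real (order L) ^ 2 * ?n ^ (order L - 1) \<le> \<delta> * ?n / 2 * ?n ^ (order L - 1)"
    using large by (intro mult_right_mono) auto
  also have "\<delta> * ?n / 2 * ?n ^ (order L - 1) = \<delta> / 2 * ?n ^ order L" by (simp add: pw)
  finally show ?thesis by simp
qed

lemma ex_number_with_digits:
  fixes n :: nat
  assumes "\<forall>i<v. \<phi> i < n"
  shows "\<exists>b<n ^ v. \<forall>i<v. b div n ^ i mod n = \<phi> i"
  using assms
proof (induction v arbitrary: \<phi>)
  case (Suc v)
  have "\<forall>i<v. \<phi> (Suc i) < n" using Suc.prems by simp
  from Suc.IH[OF this] obtain b where b: "b < n ^ v" "\<forall>i<v. b div n ^ i mod n = \<phi> (Suc i)"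
    by blast
  have n: "\<phi> 0 < n" using Suc.prems by simp
  have "\<phi> 0 + n * b < n ^ Suc v"
  proof -
    have "n * Suc b \<le> n * n ^ v" using b(1) by (intro mult_le_mono) auto
    then show ?thesis using n by simp
  qed
  moreover have "(\<phi> 0 + n * b) div n ^ i mod n = \<phi> i" if "i < Suc v" for i
  proof (cases i)
    case 0
    then show ?thesis using n by simp
  next
    case (Suc j)
    have "(\<phi> 0 + n * b) div n = b" using n by simp
    then have "(\<phi> 0 + n * b) div n ^ i = b div n ^ j" unfolding Suc by (simp add: div_mult2_eq)
    then show ?thesis using b(2) that Suc by simp
  qed
  ultimately show ?case by blast
qed simp

text \<open>The base-\<open>N\<close> digits of a number below \<open>N ^ T\<close> are independent.\<close>

lemma card_numbers_avoiding:
  fixes N :: nat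
  assumes A: "A \<subseteq> {..<N}"
  shows "card {s. s < N ^ T \<and> (\<forall>q<T. s div N ^ q mod N \<notin> A)} \<le> (N - card A) ^ T"
proof (induction T)
  case 0
  have "{s. s < N ^ 0 \<and> (\<forall>q<0. s div N ^ q mod N \<notin> A)} = {0 :: nat}" by auto
  then show ?case by simp
next
  case (Suc T)
  let ?B = "\<lambda>T. {s. s < N ^ T \<and> (\<forall>q<T. s div N ^ q mod N \<notin> A)}"
  have fA: "finite A" using A finite_subset by blast
  have "card (?B (Suc T)) \<le> card (({..<N} - A) \<times> ?B T)"
  proof (rule card_inj_on_le[where f = "\<lambda>s. (s mod N, s div N)"])
    show "inj_on (\<lambda>s. (s mod N, s div N)) (?B (Suc T))"
    proof (rule inj_onI)
      fix s t assume "(s mod N, s div N) = (t mod N, t div N)"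
      then have "s div N * N + s mod N = t div N * N + t mod N" by simp
      then show "s = t" by (simp only: div_mult_mod_eq)
    qed
    show "(\<lambda>s. (s mod N, s div N)) ` ?B (Suc T) \<subseteq> ({..<N} - A) \<times> ?B T"
    proof
      fix y assume "y \<in> (\<lambda>s. (s mod N, s div N)) ` ?B (Suc T)"
      then obtain s where s: "s < N ^ Suc T" "\<forall>q<Suc T. s div N ^ q mod N \<notin> A"
        and y: "y = (s mod N, s div N)" by auto
      have "N > 0" using s(1) by (cases N) auto
      moreover have "s div N < N ^ T" using s(1) by (simp add: less_mult_imp_div_less mult.commute)
      moreover have "s div N div N ^ q mod N \<notin> A" if "q < T" for q
        using s(2)[rule_format, of "Suc q"] that by (simp add: div_mult2_eq)
      moreover have "s mod N \<notin> A" using s(2)[rule_format, of 0] by simp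
      ultimately show "y \<in> ({..<N} - A) \<times> ?B T" by (auto simp: y)
    qed
    show "finite (({..<N} - A) \<times> ?B T)" by auto
  qed
  also have "\<dots> = (N - card A) * card (?B T)"
    using A fA by (simp add: card_cartesian_product card_Diff_subset)
  also have "\<dots> \<le> (N - card A) * (N - card A) ^ T" by (intro mult_le_mono2 Suc)
  finally show ?case by simp
qed

text \<open>A seed \<open>s < n ^ (v * T)\<close> encodes \<open>T\<close> independent uniform maps from \<open>{..<v}\<close>
  to \<open>{..<n}\<close>: the \<open>q\<close>-th map is the list of base-\<open>n\<close> digits of the \<open>q\<close>-th base-\<open>n ^ v\<close> digit.\<close>

definition sample :: "nat \<Rightarrow> nat \<Rightarrow> nat \<Rightarrow> nat \<Rightarrow> nat \<Rightarrow> nat" where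
  "sample n v s q i = s div (n ^ v) ^ q mod n ^ v div n ^ i mod n"

lemma sample_less: "n > 0 \<Longrightarrow> sample n v s q i < n"
  by (simp add: sample_def)

lemma card_seeds_missing:
  assumes L: "rgraph r L" "verts L = {..<v}" and G: "verts G = {..<n}"
  shows "card {s. s < n ^ (v * T) \<and> (\<forall>q<T. restrict (sample n v s q) {..<v} \<notin> embs L G)}
    \<le> (n ^ v - card (embs L G)) ^ T"
proof -
  let ?d = "\<lambda>b. restrict (\<lambda>i. b div n ^ i mod n) {..<v}"
  define A where "A = {b. b < n ^ v \<and> ?d b \<in> embs L G}"
  have "embs L G \<subseteq> ?d ` A"
  proof
    fix \<phi> assume \<phi>: "\<phi> \<in> embs L G"
    then have PE: "\<phi> \<in> {..<v} \<rightarrow>\<^sub>E {..<n}" by (simp add: embs_def homs_def L(2) G)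
    then obtain b where b: "b < n ^ v" "\<forall>i<v. b div n ^ i mod n = \<phi> i"
      using ex_number_with_digits[of v \<phi> n] by auto
    have "?d b = restrict \<phi> {..<v}" using b(2) by (intro restrict_ext) simp
    then have "?d b = \<phi>" unfolding PiE_restrict[OF PE] .
    moreover from this have "b \<in> A" using b(1) \<phi> by (simp only: A_def mem_Collect_eq)
    ultimately show "\<phi> \<in> ?d ` A" by (rule image_eqI[OF sym])
  qed
  moreover have "finite A" by (simp add: A_def)
  ultimately have "card (embs L G) \<le> card A" by (rule surj_card_le[rotated])
  then have "(n ^ v - card A) ^ T \<le> (n ^ v - card (embs L G)) ^ T" by (intro power_mono) auto
  moreover have "{s. s < n ^ (v * T) \<and> (\<forall>q<T. restrict (sample n v s q) {..<v} \<notin> embs L G)}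
      \<subseteq> {s. s < (n ^ v) ^ T \<and> (\<forall>q<T. s div (n ^ v) ^ q mod n ^ v \<notin> A)}"
  proof -
    have "restrict (sample n v s q) {..<v} = ?d (s div (n ^ v) ^ q mod n ^ v)" for s q
      by (intro restrict_ext) (simp add: sample_def)
    moreover have "x \<in> A \<Longrightarrow> ?d x \<in> embs L G" for x by (simp only: A_def mem_Collect_eq)
    ultimately show ?thesis unfolding power_mult by (intro Collect_mono) metis
  qed
  then have "card {s. s < n ^ (v * T) \<and> (\<forall>q<T. restrict (sample n v s q) {..<v} \<notin> embs L G)}
      \<le> card {s. s < (n ^ v) ^ T \<and> (\<forall>q<T. s div (n ^ v) ^ q mod n ^ v \<notin> A)}"
    by (intro card_mono) auto
  moreover have "\<dots> \<le> (n ^ v - card A) ^ T" by (rule card_numbers_avoiding) (auto simp: A_def)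
  ultimately show ?thesis by linarith
qed

text \<open>Each of the \<open>T\<close> samples misses with probability at most \<open>1 - \<delta> / 2\<close>; all of them miss with
  probability at most \<open>(1 - \<delta> / 2) ^ T \<le> exp (- 2) \<le> 1 / 3\<close>.\<close>

lemma card_seeds_hitting:
  assumes L: "rgraph r L" "verts L = {..<v}" and G: "verts G = {..<n}" and n: "n > 0"
    and \<delta>: "\<delta> / 2 * real n ^ v \<le> real (card (embs L G))" "\<delta> > 0" and T: "real T * \<delta> \<ge> 4"
  shows "2 / 3 * real (n ^ (v * T))
    \<le> real (card {s. s < n ^ (v * T) \<and> (\<exists>q<T. restrict (sample n v s q) {..<v} \<in> embs L G)})"
proof -
  let ?N = "n ^ (v * T)"
  let ?Y = "{s. s < ?N \<and> (\<exists>q<T. restrict (sample n v s q) {..<v} \<in> embs L G)}"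
  let ?M = "{s. s < ?N \<and> (\<forall>q<T. restrict (sample n v s q) {..<v} \<notin> embs L G)}"
  have fG: "finite (verts G)" by (simp add: G)
  have emb: "card (embs L G) \<le> n ^ v"
    using card_mono[of "homs L G" "embs L G"] finite_homs[OF L(1) fG] card_homs_le[OF L(1) fG]
    by (auto simp: embs_def L(2) G)
  have embR: "real (card (embs L G)) \<le> real n ^ v"
    using of_nat_mono[OF emb, where ?'a = real] by (simp only: of_nat_power)
  have "card ?Y + card ?M = card (?Y \<union> ?M)" by (intro card_Un_disjoint[symmetric]) auto
  also have "?Y \<union> ?M = {..<?N}" by auto
  finally have sum: "real (card ?Y) + real (card ?M) = real ?N"
    unfolding of_nat_add[symmetric] by (simp only: card_lessThan)
  have "real (card ?M) \<le> real ((n ^ v - card (embs L G)) ^ T)"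
    using card_seeds_missing[OF L G] by (simp only: of_nat_le_iff)
  also have "\<dots> = (real n ^ v - real (card (embs L G))) ^ T" using emb by (simp add: of_nat_diff)
  also have "\<dots> \<le> ((1 - \<delta> / 2) * real n ^ v) ^ T"
    using \<delta>(1) embR by (intro power_mono) (auto simp: algebra_simps)
  also have "\<dots> = (1 - \<delta> / 2) ^ T * real ?N" by (simp add: power_mult_distrib power_mult)
  also have "\<dots> \<le> 1 / 3 * real ?N"
  proof (rule mult_right_mono)
    have "\<delta> / 2 * real n ^ v \<le> real n ^ v" using \<delta>(1) embR by linarith
    then have "\<delta> \<le> 2" using n by simp
    then have "(1 - \<delta> / 2) ^ T \<le> exp (- (\<delta> / 2)) ^ T"
      using exp_ge_add_one_self[of "- (\<delta> / 2)"] by (intro power_mono) auto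
    also have "\<dots> = exp (- (real T * \<delta> / 2))" by (simp flip: exp_of_nat_mult)
    also have "\<dots> \<le> exp (- 2)" using T by simp
    also have "\<dots> \<le> 1 / 3"
      using exp_ge_add_one_self[of 2] by (simp add: exp_minus field_simps)
    finally show "(1 - \<delta> / 2) ^ T \<le> 1 / 3" .
  qed simp
  finally show ?thesis using sum by linarith
qed

section \<open>Non-adaptive algorithms\<close>

text \<open>If the next query depends only on the number of answers received so far, the queries form a
  fixed list and the transcript is a prefix of it together with the true answers.\<close>

lemma transcript_nonadaptive:
  assumes query: "\<forall>bs. length bs < length qs \<longrightarrow> move A n s bs = Query (qs ! length bs)"
    and stop: "\<forall>bs. length bs = length qs \<longrightarrow> move A n s bs = (if V bs then Reject else Accept)"
  shows "transcript A n E s k = map (\<lambda>e. (e, e \<in> E)) (take k qs)"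
proof (induction k)
  case (Suc k)
  show ?case
  proof (cases "k < length qs")
    case True
    then show ?thesis using Suc query by (simp add: take_Suc_conv_app_nth min_def)
  next
    case False
    then show ?thesis using Suc stop by simp
  qed
qed simp

lemma nonadaptive_run:
  assumes query: "\<forall>bs. length bs < length qs \<longrightarrow> move A n s bs = Query (qs ! length bs)"
    and stop: "\<forall>bs. length bs = length qs \<longrightarrow> move A n s bs = (if V bs then Reject else Accept)"
  shows "accepts A n E s \<longleftrightarrow> \<not> V (map (\<lambda>e. e \<in> E) qs)"
    and "rejects A n E s \<longleftrightarrow> V (map (\<lambda>e. e \<in> E) qs)"
    and "move A n s (map snd (transcript A n E s k)) = Reject \<Longrightarrow>
      V (map (\<lambda>e. e \<in> E) qs) \<and> transcript A n E s k = map (\<lambda>e. (e, e \<in> E)) qs"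
proof -
  note t = transcript_nonadaptive[OF assms]
  have snd: "map snd (transcript A n E s k) = map (\<lambda>e. e \<in> E) (take k qs)" for k
    by (simp add: t comp_def)
  have m: "move A n s (map snd (transcript A n E s k)) =
      (if k < length qs then Query (qs ! k) else if V (map (\<lambda>e. e \<in> E) qs) then Reject else Accept)" for k
    unfolding snd using query[rule_format, of "map (\<lambda>e. e \<in> E) (take k qs)"] stop[rule_format, of "map (\<lambda>e. e \<in> E) (take k qs)"]
    by (auto simp: min_def)
  show "accepts A n E s \<longleftrightarrow> \<not> V (map (\<lambda>e. e \<in> E) qs)"
    unfolding accepts_def m by (auto intro: exI[of _ "length qs"])
  show "rejects A n E s \<longleftrightarrow> V (map (\<lambda>e. e \<in> E) qs)"
    unfolding rejects_def m by (auto intro: exI[of _ "length qs"])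
  show "move A n s (map snd (transcript A n E s k)) = Reject \<Longrightarrow>
      V (map (\<lambda>e. e \<in> E) qs) \<and> transcript A n E s k = map (\<lambda>e. (e, e \<in> E)) qs"
    unfolding m by (auto simp: t split: if_splits)
qed

section \<open>A one-sided tester from dense embeddings\<close>

fun decode_action :: "nat \<Rightarrow> action" where
  "decode_action 0 = Accept"
| "decode_action (Suc 0) = Reject"
| "decode_action (Suc (Suc k)) = Query (set_decode k)"

lemma encode_decode_action: "encode_action (decode_action k) = k"
  by (cases k rule: decode_action.cases) auto

lemma decode_action_query: "finite e \<Longrightarrow> decode_action (2 + set_encode e) = Query e"
  by (simp add: numeral_2_eq_2)

text \<open>Moves are given by their codes, so such an algorithm is effective as soon as the two functions are
  recursive.\<close>

definition algorithm_of :: "(nat list \<Rightarrow> nat) \<Rightarrow> (nat list \<Rightarrow> nat) \<Rightarrow> algorithm" where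
  "algorithm_of f g = \<lparr>seeds = (\<lambda>n. f [n]), move = (\<lambda>n s bs.
     decode_action (g [n, s, length bs, set_encode {i. i < length bs \<and> bs ! i}]))\<rparr>"

lemma effective_algorithm_of: "recursive f \<Longrightarrow> recursive g \<Longrightarrow> effective (algorithm_of f g)"
  by (auto simp: effective_def algorithm_of_def encode_decode_action)

lemma set_decode_answers: "i \<in> set_decode (set_encode {i. i < length bs \<and> bs ! i}) \<longleftrightarrow> i < length bs \<and> bs ! i"
  by simp

definition all_edges :: "nat \<Rightarrow> nat \<Rightarrow> nat set list" where
  "all_edges r n = (SOME xs. set xs = {e. e \<subseteq> {..<n} \<and> card e = r} \<and> distinct xs)"

lemma all_edges: "set (all_edges r n) = {e. e \<subseteq> {..<n} \<and> card e = r}" "length (all_edges r n) \<le> n ^ r"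
proof -
  have "finite {e. e \<subseteq> {..<n} \<and> card e = r}" by (rule finite_subset[of _ "Pow {..<n}"]) auto
  then have "\<exists>xs. set xs = {e. e \<subseteq> {..<n} \<and> card e = r} \<and> distinct xs"
    by (rule finite_distinct_list)
  then have *: "set (all_edges r n) = {e. e \<subseteq> {..<n} \<and> card e = r} \<and> distinct (all_edges r n)"
    unfolding all_edges_def by (rule someI_ex)
  then show "set (all_edges r n) = {e. e \<subseteq> {..<n} \<and> card e = r}" ..
  from * have "length (all_edges r n) = card {e. e \<subseteq> {..<n} \<and> card e = r}"
    by (metis distinct_card)
  also have "\<dots> = n choose r" using n_subsets[of "{..<n}" r] by simp
  also have "\<dots> \<le> (n choose r) * fact r" by simp
  also have "\<dots> \<le> n ^ r" by (rule binomial_fact_pow)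
  finally show "length (all_edges r n) \<le> n ^ r" .
qed

text \<open>The arguments are the number of vertices, the number of queries made so far and the code of the
  answers. Once all edges are known, the verdict is membership in \<open>P\<close>; on boundedly many vertices
  this is a finite table.\<close>

definition exhaustive_move :: "nat \<Rightarrow> hgraph set \<Rightarrow> nat \<times> nat \<times> nat \<Rightarrow> nat" where
  "exhaustive_move r P = (\<lambda>(n, l, x). let qs = all_edges r n in
     if l < length qs then 2 + set_encode (qs ! l)
     else if \<lparr>verts = {..<n}, edges = {qs ! i |i. i < length qs \<and> i \<in> set_decode x}\<rparr> \<in> P
     then 0 else 1)"

definition exhaustive_domain :: "nat \<Rightarrow> nat \<Rightarrow> (nat \<times> nat \<times> nat) set" where
  "exhaustive_domain r N = (\<Union>n<N. \<Union>l\<le>length (all_edges r n).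
     (\<lambda>A. (n, l, set_encode A)) ` Pow {..<l})"

lemma finite_exhaustive_domain: "finite (exhaustive_domain r N)"
  by (auto simp: exhaustive_domain_def)

text \<open>Under a sample that is not injective the image of an edge can have fewer than \<open>r\<close> elements; a legal
  query is made instead, and its answer is ignored by \<open>sampling_move\<close>.\<close>

definition sampled_query :: "nat \<Rightarrow> nat \<Rightarrow> nat \<Rightarrow> nat \<Rightarrow> nat \<Rightarrow> nat set \<Rightarrow> nat set" where
  "sampled_query r n v s q e =
     (if inj_on (sample n v s q) {..<v} then sample n v s q ` e else {..<r})"

definition sampling_move :: "nat \<Rightarrow> nat \<Rightarrow> nat set list \<Rightarrow> nat \<Rightarrow> nat list \<Rightarrow> nat" where
  "sampling_move r v es T xs =
     (if arg 2 xs < T * length es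
      then \<Sum>j<T * length es. if arg 2 xs = j
        then 2 + set_encode (sampled_query r (arg 0 xs) v (arg 1 xs) (j div length es) (es ! (j mod length es)))
        else 0
      else if \<exists>q\<in>{..<T}. inj_on (sample (arg 0 xs) v (arg 1 xs) q) {..<v} \<and>
        (\<forall>i\<in>{..<length es}. arg 3 xs div 2 ^ (q * length es + i) mod 2 = 1)
      then 1 else 0)"

lemma recursive_sample: "recursive (\<lambda>xs. sample (arg 0 xs) v (arg 1 xs) q i)"
  unfolding sample_def by (intro recursive_intros)

lemma recursive_pred_inj_sample: "recursive_pred (\<lambda>xs. inj_on (sample (arg 0 xs) v (arg 1 xs) q) {..<v})"
proof -
  have "recursive_pred (\<lambda>xs. \<forall>i\<in>{..<v}. \<forall>j\<in>{..<v}.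
      i = j \<or> \<not> sample (arg 0 xs) v (arg 1 xs) q i = sample (arg 0 xs) v (arg 1 xs) q j)"
    by (intro recursive_intros recursive_sample finite_lessThan)
  moreover have "(\<forall>i\<in>{..<v}. \<forall>j\<in>{..<v}. i = j \<or> \<not> f i = f j) \<longleftrightarrow> inj_on f {..<v}" for f :: "nat \<Rightarrow> nat"
    unfolding inj_on_def by blast
  ultimately show ?thesis by simp
qed

lemma recursive_sampled_query:
  assumes "e \<subseteq> {..<v}"
  shows "recursive (\<lambda>xs. set_encode (sampled_query r (arg 0 xs) v (arg 1 xs) q e))"
proof -
  have fe: "finite e" using assms finite_subset by blast
  have eq: "set_encode (sampled_query r n v s q e) =
      (if inj_on (sample n v s q) {..<v} then \<Sum>u\<in>e. 2 ^ sample n v s q u else set_encode {..<r})" for n s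
  proof (cases "inj_on (sample n v s q) {..<v}")
    case True
    then have "inj_on (sample n v s q) e" using assms by (rule inj_on_subset)
    with True show ?thesis by (simp add: sampled_query_def set_encode_def sum.reindex)
  qed (simp add: sampled_query_def)
  show ?thesis
    unfolding eq by (intro recursive_intros recursive_pred_inj_sample recursive_sample fe)
qed

lemma recursive_sampling_move:
  assumes "\<forall>e\<in>set es. e \<subseteq> {..<v}"
  shows "recursive (sampling_move r v es T)"
proof -
  have "es ! (j mod length es) \<subseteq> {..<v}" if "j < T * length es" for j
  proof -
    have "length es > 0" using that by (cases es) auto
    then show ?thesis using assms by simp
  qed
  then show ?thesis
    unfolding sampling_move_def
    by (intro recursive_intros recursive_pred_inj_sample recursive_sampled_query finite_lessThan) auto
qed

lemma sampling_move_query: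
  assumes "l < T * length es"
  shows "sampling_move r v es T [n, s, l, x] =
    2 + set_encode (sampled_query r n v s (l div length es) (es ! (l mod length es)))"
  using assms by (simp add: sampling_move_def arg_def)

text \<open>The answers for the \<open>q\<close>-th sample are those at the positions from \<open>q * length es\<close> on.\<close>

lemma sampling_move_stop:
  assumes "length bs = T * length es"
  shows "sampling_move r v es T [n, s, length bs, set_encode {i. i < length bs \<and> bs ! i}] =
    (if \<exists>q<T. inj_on (sample n v s q) {..<v} \<and> (\<forall>i<length es. bs ! (q * length es + i)) then 1 else 0)"
proof -
  have less: "q * length es + i < T * length es" if "q < T" "i < length es" for q i
  proof -
    have "q * length es + i < Suc q * length es" using that by simp
    also have "\<dots> \<le> T * length es" using that by (intro mult_le_mono1) simp
    finally show ?thesis .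
  qed
  have bit: "set_encode {i. i < length bs \<and> bs ! i} div 2 ^ j mod 2 = 1 \<longleftrightarrow> j < length bs \<and> bs ! j" for j
    using set_decode_answers[of j bs] by (simp only: set_decode_def mem_Collect_eq odd_iff_mod_2_eq_one)
  have "(\<exists>q\<in>{..<T}. inj_on (sample n v s q) {..<v} \<and> (\<forall>i\<in>{..<length es}.
        set_encode {i. i < length bs \<and> bs ! i} div 2 ^ (q * length es + i) mod 2 = 1)) \<longleftrightarrow>
      (\<exists>q<T. inj_on (sample n v s q) {..<v} \<and> (\<forall>i<length es. bs ! (q * length es + i)))"
    unfolding bit unfolding assms using less by (auto simp: Bex_def)
  then show ?thesis by (simp add: sampling_move_def arg_def assms)
qed

lemma dist_prop_eq_0:
  assumes P: "graph_property r P" and G: "G \<in> P"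
  shows "dist_prop r P G \<le> 0"
proof -
  let ?d = "\<lambda>G'. real (card ((edges G - edges G') \<union> (edges G' - edges G))) / real (order G) ^ r"
  have rg: "rgraph r G'" if "G' \<in> P" for G' using P that by (auto simp: graph_property_def)
  have fV: "finite (verts G)" using rg[OF G] by (simp add: rgraph_def)
  have "{G' \<in> P. verts G' = verts G} \<subseteq> (\<lambda>E. \<lparr>verts = verts G, edges = E\<rparr>) ` Pow (Pow (verts G))"
  proof
    fix G' assume "G' \<in> {G' \<in> P. verts G' = verts G}"
    then have "verts G' = verts G" "edges G' \<subseteq> Pow (verts G)" using rg[of G'] by (auto simp: rgraph_def)
    then have "G' = \<lparr>verts = verts G, edges = edges G'\<rparr>" "edges G' \<in> Pow (Pow (verts G))" by auto
    then show "G' \<in> (\<lambda>E. \<lparr>verts = verts G, edges = E\<rparr>) ` Pow (Pow (verts G))" by (rule image_eqI)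
  qed
  then have "finite {G' \<in> P. verts G' = verts G}" using fV finite_subset by blast
  then have "dist_prop r P G \<le> ?d G"
    unfolding dist_prop_def using G by (intro Min_le imageI finite_imageI) simp_all
  then show ?thesis by simp
qed

text \<open>Below the threshold \<open>N\<close> the tester reads the whole input and decides exactly. From \<open>N\<close> on it looks
  for copies of \<open>L\<close> at \<open>T\<close> samples; it is one-sided because a copy of \<open>L\<close> excludes membership
  in \<open>P\<close>, and inputs far from \<open>P\<close> have so many copies that some sample hits one.\<close>

theorem ex_tester:
  assumes P: "graph_property r P"
    and L: "rgraph r L" "verts L = {..<v}"
    and sound: "\<And>G. rgraph r G \<Longrightarrow> order G \<ge> N \<Longrightarrow> contains_copy G L \<Longrightarrow> G \<notin> P"
    and dense: "\<And>n G. n \<ge> N \<Longrightarrow> G \<in> inputs r n \<Longrightarrow> dist_prop r P G \<ge> \<epsilon> \<Longrightarrow>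
      \<delta> / 2 * real n ^ v \<le> real (card (embs L G))"
    and N: "N \<ge> r" "N > 0" and \<epsilon>: "\<epsilon> > 0" and \<delta>: "\<delta> > 0" and T: "real T * \<delta> \<ge> 4"
  obtains A where "effective A" and "\<And>n. one_sided_tester r P \<epsilon> n A"
    and "\<And>n. n < N \<Longrightarrow> queries_at_most r n A (real (N ^ r))"
    and "\<And>n. n \<ge> N \<Longrightarrow> queries_at_most r n A (real (T * card (edges L)))"
    and "\<And>n. n \<ge> N \<Longrightarrow> rejects_only_after_finding r L n A"
proof -
  obtain es where es: "set es = edges L" "distinct es"
    using finite_distinct_list[OF finite_edges[OF L(1)]] by blast
  let ?m = "length es"
  have m: "?m = card (edges L)" using distinct_card[OF es(2)] es(1) by simp
  have esv: "e \<subseteq> {..<v}" "card e = r" if "e \<in> set es" for e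
    using that L es(1) by (auto simp: rgraph_def)
  let ?S = "exhaustive_domain r N"
  define f where "f xs = (if arg 0 xs < N then 1 else arg 0 xs ^ (v * T))" for xs
  define g where "g xs = (if arg 0 xs < N
    then if (arg 0 xs, arg 2 xs, arg 3 xs) \<in> ?S then exhaustive_move r P (arg 0 xs, arg 2 xs, arg 3 xs) else 0
    else sampling_move r v es T xs)" for xs
  define A where "A = algorithm_of f g"
  have rf: "recursive f"
    unfolding f_def by (intro recursive_intros)
  have rg: "recursive g"
    unfolding g_def using esv(1)
    by (intro recursive_if recursive_intros recursive_table finite_exhaustive_domain recursive_sampling_move) auto
  have eff: "effective A" unfolding A_def using rf rg by (rule effective_algorithm_of)
  have seeds_small: "seeds A n = 1" if "n < N" for n
    using that by (simp add: A_def algorithm_of_def f_def arg_def)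
  have seeds_large: "seeds A n = n ^ (v * T)" if "n \<ge> N" for n
    using that by (simp add: A_def algorithm_of_def f_def arg_def)
  have move: "move A n s bs = decode_action (g [n, s, length bs, set_encode {i. i < length bs \<and> bs ! i}])"
    for n s bs by (simp add: A_def algorithm_of_def)
  have notin: "G \<notin> P" if "dist_prop r P G \<ge> \<epsilon>" for G using dist_prop_eq_0[OF P, of G] \<epsilon> that by linarith

  have small: "one_sided_tester r P \<epsilon> n A \<and> queries_at_most r n A (real (N ^ r))" if n: "n < N" for n
  proof -
    let ?qs = "all_edges r n"
    define V where "V bs \<longleftrightarrow> \<lparr>verts = {..<n}, edges = {?qs ! i |i. i < length ?qs \<and> bs ! i}\<rparr> \<notin> P"
      for bs :: "bool list"
    have mv: "move A n s bs = decode_action (exhaustive_move r P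
        (n, length bs, set_encode {i. i < length bs \<and> bs ! i}))" if "length bs \<le> length ?qs" for s bs
    proof -
      have "(n, length bs, set_encode {i. i < length bs \<and> bs ! i}) \<in> ?S"
        unfolding exhaustive_domain_def
        by (intro UN_I[of n] UN_I[of "length bs"] image_eqI[where x = "{i. i < length bs \<and> bs ! i}"])
          (use n that in auto)
      then show ?thesis using n by (simp add: move g_def arg_def)
    qed
    have query: "\<forall>bs. length bs < length ?qs \<longrightarrow> move A n s bs = Query (?qs ! length bs)" for s
    proof (intro allI impI)
      fix bs :: "bool list" assume that: "length bs < length ?qs"
      have "?qs ! length bs \<subseteq> {..<n}" using nth_mem[OF that] unfolding all_edges(1) by simp
      then have "finite (?qs ! length bs)" by (rule finite_subset) simp
      then show "move A n s bs = Query (?qs ! length bs)"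
        using mv[of bs s] that by (simp add: exhaustive_move_def decode_action_query)
    qed
    have stop: "\<forall>bs. length bs = length ?qs \<longrightarrow> move A n s bs = (if V bs then Reject else Accept)" for s
    proof (intro allI impI)
      fix bs :: "bool list" assume that: "length bs = length ?qs"
      let ?x = "set_encode {i. i < length bs \<and> bs ! i}"
      have eq: "{?qs ! i |i. i < length ?qs \<and> i \<in> set_decode ?x} = {?qs ! i |i. i < length ?qs \<and> bs ! i}"
        unfolding set_decode_answers that by auto
      have "exhaustive_move r P (n, length bs, ?x) = (if V bs then 1 else 0)"
        unfolding exhaustive_move_def V_def Let_def prod.case eq using that by simp
      then show "move A n s bs = (if V bs then Reject else Accept)"
        using mv[of bs s] that by (simp only: order_refl) simp
    qed
    note run = nonadaptive_run[of ?qs A n _ V, OF query stop]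
      and tr = transcript_nonadaptive[of ?qs A n _ V, OF query stop]
    have V: "V (map (\<lambda>e. e \<in> edges G) ?qs) \<longleftrightarrow> G \<notin> P" if G: "G \<in> inputs r n" for G
    proof -
      have "edges G \<subseteq> set ?qs" using G unfolding all_edges(1) by (auto simp: inputs_def rgraph_def)
      then have "{?qs ! i |i. i < length ?qs \<and> map (\<lambda>e. e \<in> edges G) ?qs ! i} = edges G"
        by (fastforce simp: in_set_conv_nth)
      moreover have "G = \<lparr>verts = {..<n}, edges = edges G\<rparr>" using G by (simp add: inputs_def)
      ultimately show ?thesis unfolding V_def by simp
    qed
    have "legal_queries r n A"
      unfolding legal_queries_def tr using all_edges(1)[of r n] by (auto dest: in_set_takeD)
    moreover have "queries_at_most r n A (real (N ^ r))"
    proof -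
      have "length ?qs \<le> N ^ r" using all_edges(2)[of r n] power_mono[of n N r] n by simp
      then have "min (length ?qs) k \<le> N ^ r" for k by simp
      then show ?thesis unfolding queries_at_most_def tr length_map length_take of_nat_le_iff by blast
    qed
    moreover have "accepts A n (edges G) s" if "G \<in> inputs r n" "G \<in> P" for G s
      using V[OF that(1)] that(2) by (simp add: run)
    moreover have "real (card {s. s < seeds A n \<and> rejects A n (edges G) s}) / real (seeds A n) \<ge> 2 / 3"
      if "G \<in> inputs r n" "dist_prop r P G \<ge> \<epsilon>" for G
    proof -
      have "{s. s < seeds A n \<and> rejects A n (edges G) s} = {0}"
        using V[OF that(1)] notin[OF that(2)] by (auto simp: run seeds_small[OF n])
      then show ?thesis by (simp add: seeds_small[OF n])
    qed
    ultimately show ?thesis unfolding one_sided_tester_def by (simp add: seeds_small[OF n])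
  qed

  have large: "one_sided_tester r P \<epsilon> n A \<and> queries_at_most r n A (real (T * card (edges L))) \<and>
      rejects_only_after_finding r L n A" if n: "n \<ge> N" for n
  proof -
    have n0: "n > 0" "r \<le> n" using n N by auto
    define qs where "qs s = map (\<lambda>j. sampled_query r n v s (j div ?m) (es ! (j mod ?m))) [0..<T * ?m]" for s
    define V where "V s bs \<longleftrightarrow> (\<exists>q<T. inj_on (sample n v s q) {..<v} \<and> (\<forall>i<?m. bs ! (q * ?m + i)))"
      for s and bs :: "bool list"
    have sq: "sampled_query r n v s q e \<subseteq> {..<n}" "card (sampled_query r n v s q e) = r"
      if "e \<in> set es" for s q e
      using esv[OF that] n0 sample_less[OF n0(1)]
      by (auto simp: sampled_query_def card_image inj_on_subset)
    have len: "length (qs s) = T * ?m" for s by (simp add: qs_def)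
    have es_nth: "es ! (j mod ?m) \<in> set es" if "j < T * ?m" for j
    proof -
      have "?m > 0" using that by (cases es) auto
      then show ?thesis by simp
    qed
    have mv: "move A n s bs = decode_action (sampling_move r v es T
        [n, s, length bs, set_encode {i. i < length bs \<and> bs ! i}])" for s bs
      using n by (simp add: move g_def arg_def[of 0])
    have query: "\<forall>bs. length bs < length (qs s) \<longrightarrow> move A n s bs = Query (qs s ! length bs)" for s
    proof (intro allI impI)
      fix bs :: "bool list" assume "length bs < length (qs s)"
      then have l: "length bs < T * ?m" by (simp add: len)
      have "finite (sampled_query r n v s (length bs div ?m) (es ! (length bs mod ?m)))"
        using sq(1)[OF es_nth[OF l]] finite_subset by blast
      then show "move A n s bs = Query (qs s ! length bs)"
        using l by (simp add: mv sampling_move_query decode_action_query qs_def)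
    qed
    have stop: "\<forall>bs. length bs = length (qs s) \<longrightarrow> move A n s bs = (if V s bs then Reject else Accept)" for s
    proof (intro allI impI)
      fix bs :: "bool list" assume "length bs = length (qs s)"
      then have "length bs = T * ?m" by (simp add: len)
      then have "sampling_move r v es T [n, s, length bs, set_encode {i. i < length bs \<and> bs ! i}]
          = (if V s bs then 1 else 0)"
        unfolding V_def by (rule sampling_move_stop)
      then show "move A n s bs = (if V s bs then Reject else Accept)" by (simp add: mv)
    qed
    note run = nonadaptive_run[of "qs s" A n s "V s" for s, OF query stop]
      and tr = transcript_nonadaptive[of "qs s" A n s "V s" for s, OF query stop]
    have idx: "q * ?m + i < T * ?m" "qs s ! (q * ?m + i) = sampled_query r n v s q (es ! i)"
      if "q < T" "i < ?m" for q i s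
    proof -
      have "q * ?m + i < Suc q * ?m" using that by simp
      also have "\<dots> \<le> T * ?m" using that by (intro mult_le_mono1) simp
      finally show l: "q * ?m + i < T * ?m" .
      have div: "(q * m + i) div m = q" if "i < m" for m q i :: nat using that by simp
      have "(q * ?m + i) div ?m = q" "(q * ?m + i) mod ?m = i"
        using that by (auto simp only: div mod_mult_self3 mod_less)
      then show "qs s ! (q * ?m + i) = sampled_query r n v s q (es ! i)"
        using l by (simp add: qs_def)
    qed
    have hit: "inj_on (sample n v s q) {..<v} \<and> (\<forall>i<?m. map (\<lambda>e. e \<in> edges G) (qs s) ! (q * ?m + i)) \<longleftrightarrow>
        restrict (sample n v s q) {..<v} \<in> embs L G"
      if G: "G \<in> inputs r n" and q: "q < T" for G s q
    proof -
      let ?\<phi> = "restrict (sample n v s q) {..<v}"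
      have img: "?\<phi> ` e = sample n v s q ` e" if "e \<in> set es" for e using esv(1)[OF that] by force
      have "?\<phi> \<in> {..<v} \<rightarrow>\<^sub>E {..<n}" using sample_less[OF n0(1)] by auto
      then have "?\<phi> \<in> embs L G \<longleftrightarrow> inj_on (sample n v s q) {..<v} \<and> (\<forall>e\<in>set es. ?\<phi> ` e \<in> edges G)"
        using G by (auto simp: embs_def homs_def inputs_def L(2) es(1))
      also have "\<dots> \<longleftrightarrow> inj_on (sample n v s q) {..<v} \<and> (\<forall>e\<in>set es. sampled_query r n v s q e \<in> edges G)"
        using img by (auto simp: sampled_query_def)
      also have "\<dots> \<longleftrightarrow> inj_on (sample n v s q) {..<v} \<and> (\<forall>i<?m. map (\<lambda>e. e \<in> edges G) (qs s) ! (q * ?m + i))"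
        using idx[OF q] by (auto simp: all_set_conv_all_nth len)
      finally show ?thesis ..
    qed
    then have V: "V s (map (\<lambda>e. e \<in> edges G) (qs s)) \<longleftrightarrow> (\<exists>q<T. restrict (sample n v s q) {..<v} \<in> embs L G)"
      if "G \<in> inputs r n" for G s
      unfolding V_def using that by blast
    have "legal_queries r n A"
    proof -
      have "e \<subseteq> {..<n} \<and> card e = r" if mem: "e \<in> set (qs s)" for e s
      proof -
        obtain j where "j < T * ?m" "e = sampled_query r n v s (j div ?m) (es ! (j mod ?m))"
          using mem by (auto simp: qs_def)
        then show ?thesis using sq es_nth by blast
      qed
      then have "\<forall>e\<in>set (take k (qs s)). e \<subseteq> {..<n} \<and> card e = r" for k s
        using in_set_takeD by metis
      then show ?thesis unfolding legal_queries_def tr by simp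
    qed
    moreover have "queries_at_most r n A (real (T * card (edges L)))"
      unfolding queries_at_most_def tr length_map length_take len m of_nat_le_iff by simp
    moreover have "accepts A n (edges G) s" if "G \<in> inputs r n" "G \<in> P" for G s
    proof -
      have "\<not> contains_copy G L" using sound[of G] that n by (auto simp: inputs_def)
      then show ?thesis using V[OF that(1)] by (auto simp: run contains_copy_def)
    qed
    moreover have "real (card {s. s < seeds A n \<and> rejects A n (edges G) s}) / real (seeds A n) \<ge> 2 / 3"
      if G: "G \<in> inputs r n" "dist_prop r P G \<ge> \<epsilon>" for G
    proof -
      have vG: "verts G = {..<n}" using G by (simp add: inputs_def)
      have "2 / 3 * real (seeds A n) \<le> real (card {s. s < seeds A n \<and> rejects A n (edges G) s})"
        using card_seeds_hitting[OF L vG n0(1) dense[OF n G] \<delta> T]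
        by (simp only: seeds_large[OF n] run V[OF G(1)])
      moreover have "real (seeds A n) > 0" using n0 by (simp add: seeds_large[OF n])
      ultimately show ?thesis by (simp add: pos_le_divide_eq)
    qed
    moreover have "rejects_only_after_finding r L n A"
      unfolding rejects_only_after_finding_def
    proof (intro ballI allI impI)
      fix G s k assume G: "G \<in> inputs r n"
        and rej: "move A n s (map snd (transcript A n (edges G) s k)) = Reject"
      from run(3)[OF rej] have v: "V s (map (\<lambda>e. e \<in> edges G) (qs s))"
        and t: "transcript A n (edges G) s k = map (\<lambda>e. (e, e \<in> edges G)) (qs s)" by auto
      obtain q where q: "q < T" "restrict (sample n v s q) {..<v} \<in> embs L G" using V[OF G] v by blast
      let ?\<phi> = "restrict (sample n v s q) {..<v}"
      have "(?\<phi> ` e, True) \<in> set (transcript A n (edges G) s k)" if e: "e \<in> edges L" for e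
      proof -
        obtain i where i: "i < ?m" "e = es ! i" using e unfolding es(1)[symmetric] in_set_conv_nth by blast
        have "?\<phi> ` e = sample n v s q ` e" using esv(1)[of e] e es(1) by force
        moreover have "inj_on (sample n v s q) {..<v}" using hit[OF G q(1)] q(2) by blast
        ultimately have "?\<phi> ` e = qs s ! (q * ?m + i)"
          using idx(2)[OF q(1) i(1)] i(2) by (simp add: sampled_query_def)
        then have "?\<phi> ` e \<in> set (qs s)" using idx(1)[OF q(1) i(1)] by (simp add: len)
        moreover have "?\<phi> ` e \<in> edges G" using q(2) e by (auto simp: embs_def homs_def)
        ultimately show ?thesis unfolding t by force
      qed
      then show "\<exists>\<phi>\<in>embs L G. \<forall>e\<in>edges L. (\<phi> ` e, True) \<in> set (transcript A n (edges G) s k)"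
        using q(2) by blast
    qed
    ultimately show ?thesis
      unfolding one_sided_tester_def using n0 by (simp add: seeds_large[OF n])
  qed
  have "one_sided_tester r P \<epsilon> n A" for n using small[of n] large[of n] by (cases "n < N") auto
  then show thesis using that[OF eff] small large by blast
qed

section \<open>Copies of the core and copies of the graph\<close>

lemma embs_from_isomorphic:
  assumes f: "bij_betw f (verts K) (verts L)" "edges L = (`) f ` edges K"
    and K: "rgraph r K" and \<phi>: "\<phi> \<in> embs L G"
  shows "restrict (\<phi> \<circ> f) (verts K) \<in> embs K G"
    and "e \<in> edges K \<Longrightarrow> restrict (\<phi> \<circ> f) (verts K) ` e = \<phi> ` f ` e"
proof -
  have im: "f ` verts K = verts L" and inj: "inj_on f (verts K)" using f by (auto simp: bij_betw_def)
  show img: "restrict (\<phi> \<circ> f) (verts K) ` e = \<phi> ` f ` e" if "e \<in> edges K" for e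
  proof -
    have "e \<subseteq> verts K" using K that by (auto simp: rgraph_def)
    then show ?thesis by (force simp: image_image)
  qed
  have "\<phi> ` f ` e \<in> edges G" if "e \<in> edges K" for e
    using \<phi> that by (auto simp: embs_def homs_def f(2))
  then have "\<forall>e\<in>edges K. restrict (\<phi> \<circ> f) (verts K) ` e \<in> edges G" using img by metis
  moreover have "\<phi> (f v) \<in> verts G" if "v \<in> verts K" for v
    using \<phi> im that by (auto simp: embs_def homs_def)
  then have "restrict (\<phi> \<circ> f) (verts K) \<in> verts K \<rightarrow>\<^sub>E verts G" by auto
  moreover have "inj_on (\<phi> \<circ> f) (verts K)"
    using inj \<phi> by (intro comp_inj_on) (auto simp: im embs_def)
  ultimately show "restrict (\<phi> \<circ> f) (verts K) \<in> embs K G" by (simp add: embs_def homs_def)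
qed

text \<open>The isolated vertices can be placed on any unused vertices of \<open>G\<close>.\<close>

lemma contains_copy_if_core:
  assumes H: "rgraph r H" and G: "finite (verts G)" "order H \<le> order G"
    and \<phi>: "\<phi> \<in> embs (core H) G"
  shows "contains_copy G H"
proof -
  let ?V = "verts H" and ?S = "verts (core H)"
  have fV: "finite ?V" and S: "?S \<subseteq> ?V" using H by (auto simp: rgraph_def core_def)
  have fS: "finite ?S" using fV S by (rule finite_subset[rotated])
  have inj: "inj_on \<phi> ?S" and im: "\<phi> ` ?S \<subseteq> verts G" using \<phi> by (auto simp: embs_def homs_def)
  have "card (?V - ?S) \<le> card (verts G - \<phi> ` ?S)"
    using G(2) fV fS S im G(1) inj by (simp add: card_Diff_subset card_image)
  then obtain \<psi> where \<psi>: "\<psi> ` (?V - ?S) \<subseteq> verts G - \<phi> ` ?S" "inj_on \<psi> (?V - ?S)"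
    using card_le_inj[of "?V - ?S" "verts G - \<phi> ` ?S"] fV G(1) by auto
  define \<chi> where "\<chi> = restrict (\<lambda>v. if v \<in> ?S then \<phi> v else \<psi> v) ?V"
  have \<chi>S: "\<chi> v = \<phi> v" if "v \<in> ?S" for v using that S by (auto simp: \<chi>_def)
  have \<chi>R: "\<chi> v = \<psi> v" if "v \<in> ?V - ?S" for v using that by (auto simp: \<chi>_def)
  have "\<chi> ` e \<in> edges G" if "e \<in> edges H" for e
  proof -
    have "e \<subseteq> ?S" using H that by (auto simp: rgraph_def core_def)
    then have "\<chi> ` e = \<phi> ` e" using \<chi>S by (intro image_cong) auto
    then show ?thesis using \<phi> that by (auto simp: embs_def homs_def)
  qed
  moreover have "\<chi> \<in> ?V \<rightarrow>\<^sub>E verts G"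
  proof (rule PiE_I)
    fix v assume "v \<in> ?V"
    then show "\<chi> v \<in> verts G" using \<chi>S[of v] \<chi>R[of v] im \<psi>(1) by (cases "v \<in> ?S") auto
  qed (simp add: \<chi>_def)
  moreover have "inj_on \<chi> (?S \<union> (?V - ?S))"
    unfolding inj_on_Un
  proof (intro conjI)
    show "inj_on \<chi> ?S" using inj inj_on_cong[of ?S \<chi> \<phi>] \<chi>S by blast
    show "inj_on \<chi> (?V - ?S)" using \<psi>(2) inj_on_cong[of "?V - ?S" \<chi> \<psi>] \<chi>R by blast
    have "\<chi> ` ?S = \<phi> ` ?S" "\<chi> ` (?V - ?S) = \<psi> ` (?V - ?S)" using \<chi>S \<chi>R by (auto intro!: image_cong)
    then show "\<chi> ` (?S - (?V - ?S)) \<inter> \<chi> ` (?V - ?S - ?S) = {}" using \<psi>(1) by auto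
  qed
  then have "inj_on \<chi> ?V" using S by (simp add: Un_absorb1)
  ultimately show ?thesis by (auto simp: contains_copy_def embs_def homs_def)
qed

theorem theorem4p8:
  fixes r :: nat and F :: hgraph and P W :: "hgraph set" and c C a b :: real
  assumes "r \<ge> 2"
    and "rgraph r F" and "edges F \<noteq> {}" and "\<forall>v\<in>verts F. \<exists>e\<in>edges F. v \<in> e"
    and "graph_property r P"
    and "\<forall>H\<in>W. rgraph r H \<and> edges H \<noteq> {}"
    and "\<forall>G. \<forall>H\<in>W. rgraph r G \<and> contains_copy G H \<longrightarrow> G \<notin> P"
    and "c > 0" and "C > 0" and "abundant r F W c C"
    and "decidable_property r P"
    and "a > 0" and "a \<le> 1" and "b > 0"
    and "\<forall>G. rgraph r G \<longrightarrow> dist_free r F G \<ge> a * dist_prop r P G powr b"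
  shows "\<exists>W0\<in>W. \<exists>\<kappa>>0. \<exists>D>0.
    int (order (core W0)) \<le> \<lfloor>2 * real r * (C + 1)\<rfloor> \<and>
    (\<forall>\<epsilon>. 0 < \<epsilon> \<and> \<epsilon> \<le> 1 \<longrightarrow>
      (\<exists>A. effective A \<and>
        (\<forall>n. one_sided_tester r P \<epsilon> n A \<and> queries_at_most r n A (\<kappa> * \<epsilon> powr (- D))) \<and>
        (\<exists>n1. \<forall>n\<ge>n1. rejects_only_after_finding r (core W0) n A)))"
proof -
  have W: "\<forall>H\<in>W. rgraph r H" using assms(6) by blast
  obtain H L f where HW: "H \<in> W" and small: "real (order (core H)) \<le> real r * (C + 1)"
    and f: "bij_betw f (verts (core H)) (verts L)" "edges L = (`) f ` edges H"
    and vL: "verts L = {..<order (core H)}" and L: "rgraph r L"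
    and pa: "polynomially_abundant r F {L}"
    by (rule ex_abundant_core[OF assms(10) W assms(2,3,1,8,9)])
  have H: "rgraph r H" and Hne: "edges H \<noteq> {}" using assms(6) HW by auto
  have cH: "rgraph r (core H)" by (rule rgraph_core[OF H])
  define v where "v = order (core H)"
  have vL': "verts L = {..<v}" "order L = v" using vL by (auto simp: v_def)
  have v0: "v > 0"
  proof -
    obtain e where "e \<in> edges L" using Hne f(2) by auto
    then have e: "e \<subseteq> {..<v}" "card e = r" using L vL' by (auto simp: rgraph_def)
    have "r \<le> v" using card_mono[OF _ e(1)] e(2) by simp
    then show ?thesis using assms(1) by simp
  qed
  obtain \<kappa>0 D0 where \<kappa>0: "\<kappa>0 > 0" "D0 > 0" and dense0: "\<And>G \<epsilon>. rgraph r G \<Longrightarrow> order G > 0 \<Longrightarrow> \<epsilon> > 0 \<Longrightarrow>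
      \<epsilon> * real (order G) ^ r \<le> real (deletion_number F G) \<Longrightarrow> \<kappa>0 * \<epsilon> powr D0 \<le> hom_density L G"
    using pa unfolding polynomially_abundant_def by blast
  \<comment> \<open>Distance \<open>\<epsilon>\<close> from \<open>P\<close> gives distance \<open>a * \<epsilon> powr b\<close> from \<open>F\<close>-free, hence density at least
    \<open>\<kappa>0 * (a * \<epsilon> powr b) powr D0\<close>; this is at least \<open>\<mu> * \<epsilon> powr D1\<close>.\<close>
  define D1 where "D1 = b * D0"
  define \<mu> where "\<mu> = min 1 (\<kappa>0 * a powr D0)"
  define M where "M = real (order H) + real r + 2 + 2 * real v ^ 2 + 5 * real (card (edges L))"
  have D1: "D1 > 0" using assms(14) \<kappa>0 by (simp add: D1_def)
  have \<mu>: "0 < \<mu>" "\<mu> \<le> 1" "\<mu> \<le> \<kappa>0 * a powr D0" using \<kappa>0 assms(12) by (auto simp: \<mu>_def)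
  have M: "M \<ge> 1" by (simp add: M_def)
  define \<kappa> where "\<kappa> = (M / \<mu>) ^ r"
  define D where "D = D1 * real r"
  have \<kappa>: "\<kappa> > 0" using \<mu> M by (simp add: \<kappa>_def)
  have D: "D > 0" using D1 assms(1) by (simp add: D_def)
  have bound: "int (order (core H)) \<le> \<lfloor>2 * real r * (C + 1)\<rfloor>"
  proof -
    have "0 \<le> real r * (C + 1)" using assms(9) by simp
    then show ?thesis using small unfolding le_floor_iff of_int_of_nat_eq by linarith
  qed
  have testers: "\<exists>A. effective A \<and>
      (\<forall>n. one_sided_tester r P \<epsilon> n A \<and> queries_at_most r n A (\<kappa> * \<epsilon> powr (- D))) \<and>
      (\<exists>n1. \<forall>n\<ge>n1. rejects_only_after_finding r (core H) n A)"
    if \<epsilon>: "0 < \<epsilon>" "\<epsilon> \<le> 1" for \<epsilon>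
  proof -
    define \<delta> where "\<delta> = \<mu> * \<epsilon> powr D1"
    have \<delta>: "\<delta> > 0" using \<mu> \<epsilon> by (simp add: \<delta>_def)
    have "\<epsilon> powr D1 \<le> 1" using \<epsilon> D1 by (simp add: powr_le1)
    then have \<delta>1: "\<delta> \<le> 1" using \<mu> \<epsilon> unfolding \<delta>_def by (intro mult_le_one) auto
    \<comment> \<open>\<open>N\<close> leaves room for the isolated vertices of \<open>H\<close> and for legal queries, and makes non-injective
      homomorphisms rare.\<close>
    define N where "N = order H + r + 1 + nat \<lceil>2 * real v ^ 2 / \<delta>\<rceil>"
    define T where "T = nat \<lceil>4 / \<delta>\<rceil>"
    have q\<delta>: "0 \<le> 2 * real v ^ 2 / \<delta>" "0 \<le> 4 / \<delta>" using \<delta> by auto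
    have N_ge: "2 * real v ^ 2 / \<delta> \<le> real N" unfolding N_def by linarith
    have T_ge: "4 \<le> real T * \<delta>"
    proof -
      have "4 / \<delta> \<le> real T" unfolding T_def by linarith
      then show ?thesis using \<delta> by (simp add: pos_divide_le_eq)
    qed
    \<comment> \<open>The threshold \<open>N\<close> and the sample size \<open>T\<close> are polynomial in \<open>1 / \<epsilon>\<close>.\<close>
    have NM: "real N \<le> M / \<delta>" and TM: "real (T * card (edges L)) \<le> M / \<delta>" and M1: "1 \<le> M / \<delta>"
    proof -
      have one: "x \<le> x / \<delta>" if "x \<ge> 0" for x
        using that \<delta> \<delta>1 mult_left_le[of \<delta> x] by (simp add: pos_le_divide_eq)
      have "real N \<le> (real (order H) + real r + 2) + 2 * real v ^ 2 / \<delta>"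
        using q\<delta> unfolding N_def by linarith
      also have "\<dots> \<le> (real (order H) + real r + 2) / \<delta> + 2 * real v ^ 2 / \<delta>"
        using one by (intro add_mono) auto
      also have "\<dots> \<le> M / \<delta>" unfolding M_def add_divide_distrib[symmetric] using \<delta>
        by (intro divide_right_mono) auto
      finally show "real N \<le> M / \<delta>" .
      have "real T \<le> 4 / \<delta> + 1" using q\<delta> unfolding T_def by linarith
      also have "\<dots> \<le> 4 / \<delta> + 1 / \<delta>" using one by (intro add_mono) auto
      also have "\<dots> = 5 / \<delta>" by (simp add: add_divide_distrib[symmetric])
      finally have "real T * real (card (edges L)) \<le> 5 / \<delta> * real (card (edges L))"
        by (intro mult_right_mono) auto
      also have "\<dots> = (5 * real (card (edges L))) / \<delta>" by simp
      also have "\<dots> \<le> M / \<delta>" unfolding M_def using \<delta> by (intro divide_right_mono) auto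
      finally show "real (T * card (edges L)) \<le> M / \<delta>" by simp
      show "1 \<le> M / \<delta>" using one[of 1] divide_right_mono[OF M, of \<delta>] \<delta> by linarith
    qed
    have power_bound: "(M / \<delta>) ^ r = \<kappa> * \<epsilon> powr (- D)"
    proof -
      have "M / \<delta> = (M / \<mu>) * \<epsilon> powr (- D1)" using \<epsilon> \<mu> by (simp add: \<delta>_def powr_minus field_simps)
      then have "(M / \<delta>) ^ r = \<kappa> * (\<epsilon> powr (- D1)) ^ r" by (simp only: power_mult_distrib \<kappa>_def)
      also have "(\<epsilon> powr (- D1)) ^ r = \<epsilon> powr (- D)" using \<epsilon> by (simp add: powr_power D_def mult.commute)
      finally show ?thesis .
    qed
    have q_small: "real (N ^ r) \<le> \<kappa> * \<epsilon> powr (- D)"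
      unfolding power_bound[symmetric] of_nat_power by (intro power_mono NM) simp
    have q_large: "real (T * card (edges L)) \<le> \<kappa> * \<epsilon> powr (- D)"
      unfolding power_bound[symmetric] using TM self_le_power[OF M1, of r] assms(1) by linarith
    have sound: "G \<notin> P" if G: "rgraph r G" "order G \<ge> N" "contains_copy G L" for G
    proof -
      obtain \<phi> where "\<phi> \<in> embs L G" using G(3) by (auto simp: contains_copy_def)
      then have "restrict (\<phi> \<circ> f) (verts (core H)) \<in> embs (core H) G"
        using f cH by (intro embs_from_isomorphic(1)[where L = L]) auto
      moreover have "finite (verts G)" "order H \<le> order G" using G by (auto simp: rgraph_def N_def)
      ultimately have "contains_copy G H" using H by (intro contains_copy_if_core)
      then show ?thesis using assms(7) HW G(1) by blast
    qed
    have dense: "\<delta> / 2 * real n ^ v \<le> real (card (embs L G))"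
      if n: "n \<ge> N" and G: "G \<in> inputs r n" and far: "dist_prop r P G \<ge> \<epsilon>" for n G
    proof -
      have rG: "rgraph r G" and vG: "verts G = {..<n}" "order G = n" using G by (auto simp: inputs_def)
      have n0: "n > 0" using n by (simp add: N_def)
      have "a * \<epsilon> powr b \<le> a * dist_prop r P G powr b"
        using far \<epsilon> assms(12,14) by (intro mult_left_mono powr_mono2) auto
      also have "\<dots> \<le> dist_free r F G" using assms(15) rG by blast
      finally have "a * \<epsilon> powr b * real (order G) ^ r \<le> real (deletion_number F G)"
        using n0 by (simp add: dist_free_def vG pos_le_divide_eq)
      moreover have "a * \<epsilon> powr b > 0" using assms(12) \<epsilon> by simp
      ultimately have "\<kappa>0 * (a * \<epsilon> powr b) powr D0 \<le> hom_density L G"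
        using dense0[OF rG] n0 vG by auto
      moreover have "\<delta> \<le> \<kappa>0 * (a * \<epsilon> powr b) powr D0"
      proof -
        have "\<delta> \<le> (\<kappa>0 * a powr D0) * \<epsilon> powr D1" unfolding \<delta>_def using \<mu>(3) by (intro mult_right_mono) auto
        also have "\<dots> = \<kappa>0 * (a * \<epsilon> powr b) powr D0"
          using assms(12) \<epsilon> by (simp add: powr_mult powr_powr D1_def)
        finally show ?thesis .
      qed
      ultimately have "\<delta> \<le> hom_density L G" by linarith
      moreover have "2 * real (order L) ^ 2 \<le> \<delta> * real (order G)"
      proof -
        have "2 * real v ^ 2 / \<delta> \<le> real n" using N_ge n by linarith
        then show ?thesis using \<delta> by (simp add: pos_divide_le_eq vL' vG mult.commute)
      qed
      ultimately have "\<delta> / 2 * real (order G) ^ order L \<le> real (card (embs L G))"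
        using v0 n0 by (intro card_embs_ge[OF L]) (auto simp: vL' vG)
      then show ?thesis by (simp add: vL' vG)
    qed
    obtain A where A: "effective A" "\<And>n. one_sided_tester r P \<epsilon> n A"
      "\<And>n. n < N \<Longrightarrow> queries_at_most r n A (real (N ^ r))"
      "\<And>n. n \<ge> N \<Longrightarrow> queries_at_most r n A (real (T * card (edges L)))"
      "\<And>n. n \<ge> N \<Longrightarrow> rejects_only_after_finding r L n A"
      by (rule ex_tester[OF assms(5) L vL'(1) sound dense _ _ \<epsilon>(1) \<delta> T_ge]) (auto simp: N_def)
    have mono: "queries_at_most r n A q \<Longrightarrow> q \<le> q' \<Longrightarrow> queries_at_most r n A q'" for n q q'
      unfolding queries_at_most_def by (meson order_trans)
    have "queries_at_most r n A (\<kappa> * \<epsilon> powr (- D))" for n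
      using mono[OF A(3) q_small] mono[OF A(4) q_large] by (cases "n < N") auto
    moreover have "rejects_only_after_finding r (core H) n A" if n: "n \<ge> N" for n
      unfolding rejects_only_after_finding_def
    proof (intro ballI allI impI)
      fix G s k assume "G \<in> inputs r n" "s < seeds A n"
        and "move A n s (map snd (transcript A n (edges G) s k)) = Reject"
      then obtain \<phi> where \<phi>: "\<phi> \<in> embs L G" "\<forall>e\<in>edges L. (\<phi> ` e, True) \<in> set (transcript A n (edges G) s k)"
        using A(5)[OF n] unfolding rejects_only_after_finding_def by blast
      let ?\<psi> = "restrict (\<phi> \<circ> f) (verts (core H))"
      have f': "edges L = (`) f ` edges (core H)" using f(2) by simp
      have "?\<psi> \<in> embs (core H) G" by (rule embs_from_isomorphic(1)[OF f(1) f' cH \<phi>(1)])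
      moreover have "(?\<psi> ` e, True) \<in> set (transcript A n (edges G) s k)" if "e \<in> edges (core H)" for e
        unfolding embs_from_isomorphic(2)[OF f(1) f' cH \<phi>(1) that] using \<phi>(2) that f' by blast
      ultimately show "\<exists>\<phi>\<in>embs (core H) G. \<forall>e\<in>edges (core H). (\<phi> ` e, True) \<in> set (transcript A n (edges G) s k)"
        by blast
    qed
    ultimately show ?thesis using A(1,2) by blast
  qed
  show ?thesis
    by (rule bexI[OF _ HW], rule exI[of _ \<kappa>], rule conjI[OF \<kappa>], rule exI[of _ D], rule conjI[OF D],
        rule conjI[OF bound]) (intro allI impI, elim conjE, rule testers)
qed

end
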